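(* Let $\nu$ be a lattice path from $(0,0)$ to $(b,a)$, and let $P_\nu$ be the poset of $\nu$-Schröder paths or the poset of $\nu$-Schröder trees. Let $\widehat{P}_\nu$ denote $P_\nu$ with an adjoined minimal element $\hat 0$ and an adjoined maximal element $\hat 1$. Then $\widehat{P}_\nu$ is a lattice. Furthermore, every interval $[x,y]$ in $\widehat{P}_\nu\setminus\{\hat 1\}$ is an Eulerian lattice.
   Context: A lattice is Eulerian if every nontrivial interval has an equal number of elements in the even ranks versus the odd ranks. A lattice path from $(0,0)$ to $(b,a)\in\mathbb{Z}_{\ge0}^2$ is a sequence of $a$ north steps $N=(0,1)$ and $b$ east steps $E=(1,0)$. Trees. $R_\nu$ is the region weakly above $\nu$ inside the rectangle with corners $(0,0)$ and $(b,a)$. Two lattice points $p,q$ in $R_\nu$ are $\nu$-incompatible if $p$ is strictly southwest or strictly northeast of $q$ and the smallest rectangle containing $p$ and $q$ is contained in $R_\nu$; otherwise they are $\nu$-compatible. A $\nu$-Schröder tree is a set $T$ of pairwise $\nu$-compatible lattice points in $R_\nu$ which includes the point $(0,a)$ (the root) and such that each row and each column of the grid contains at least one point of $T$. The parent of a non-root point $p\in T$ is the nearest point of $T$ above $p$ in its column, or the nearest point of $T$ to the left of $p$ in its row, if one of these exists (both cannot exist); otherwise it is the unique point $q\in T$ strictly northwest of $p$ such that the box with opposite corners $p,q$ contains no other point of $T$. Contractions of a $\nu$-Schröder tree $S$: (right) if $q\in S$ has a point of $S$ above it in its column and a point of $S$ to its right in its row, remove $q$; (left) if $q\in S$ has a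 point of $S$ to its left in its row and a point of $S$ below it in its column, remove $q$; (diagonal) if $r\in S$ is strictly southeast of its parent $p$, with neither of the other two corners of the box determined by $p$ and $r$ in $S$, and $S\setminus\{r\}$ is a $\nu$-Schröder tree, remove $r$. The poset of $\nu$-Schröder trees has cover relation $T\prec T'$ iff $T'$ is a contraction of $T$. Paths. A $\nu$-Schröder path is a path from $(0,0)$ to $(b,a)$ with steps $N$, $E$, $D=(1,1)$ which stays weakly above $\nu$. For a lattice point $p$ of such a path, $\mathrm{horiz}_\nu(p)$ is the maximal number of east steps that can be placed starting at $p$ before crossing $\nu$ (while remaining in the smallest rectangle containing $\nu$). The (contraction) poset of $\nu$-Schröder paths has cover relation $\mu\prec\lambda$ iff $\lambda$ is obtained from $\mu$ by one of the following contractions: 1. Right contraction: replace a consecutive $EN$ pair with $D$. 2. Left contraction: let $q$ be the initial point of an $E$ step and let $r$ be the last lattice point of the path before $q$ with $\mathrm{horiz}_\nu(r)=\mathrm{horiz}_\nu(q)$; if the step starting at $r$ is an $N$ step, delete this $E$ step and this $N$ step, shift the subpath between the deleted steps one unit to the right, and place a $D$ step at $r$. 3. Diagonal contraction: let $r$ be a point which is the end point of an $E$ step and the initial point of a $D$ step, and let $s$ be the last lattice point of the path before $r$ with $\mathrm{horiz}_\nu(s)=\mathrm{horiz}_\nu(r)$; if the step starting at $s$ is an $N$ step, delete this $E$ step and this $N$ step, shift the subpath between the deleted steps one unit to the right, and place a $D$ step at $s$. *)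

theory Defs
  imports "HOL-Algebra.Complete_Lattice"
begin

datatype step = North | East | Diag

definition end_point :: "step list \<Rightarrow> nat \<times> nat" where
  "end_point w = (count_list w East + count_list w Diag, count_list w North + count_list w Diag)"

text \<open>Points are pairs (horizontal, vertical); a path with \<open>a\<close> north steps and \<open>b\<close> east steps
  ends in \<open>(b, a)\<close>.\<close>

definition lattice_path :: "step list \<Rightarrow> nat \<times> nat \<Rightarrow> bool" where
  "lattice_path w p \<longleftrightarrow> set w \<subseteq> {North, East} \<and> end_point w = p"

definition vertices :: "step list \<Rightarrow> (nat \<times> nat) set" where
  "vertices w = {end_point u | u v. w = u @ v}"

text \<open>The lattice points of \<open>R\<^sub>\<nu>\<close>. A rectangle with lattice corners lies in the planar
  region iff all of its lattice points are in this set.\<close>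

definition region :: "step list \<Rightarrow> (nat \<times> nat) set" where
  "region \<nu> = {(x, y). x \<le> fst (end_point \<nu>) \<and> y \<le> snd (end_point \<nu>) \<and>
                      (\<exists>y'\<le>y. (x, y') \<in> vertices \<nu>)}"

definition poset_of_covers :: "'a set \<Rightarrow> ('a \<Rightarrow> 'a \<Rightarrow> bool) \<Rightarrow> 'a gorder" where
  "poset_of_covers A R =
     \<lparr> carrier = A, eq = (=), le = (\<lambda>x y. x \<in> A \<and> y \<in> A \<and> R x y)\<^sup>*\<^sup>* \<rparr>"

definition strictly_southwest :: "nat \<times> nat \<Rightarrow> nat \<times> nat \<Rightarrow> bool" where
  "strictly_southwest p q \<longleftrightarrow> fst p < fst q \<and> snd p < snd q"

definition strictly_northwest :: "nat \<times> nat \<Rightarrow> nat \<times> nat \<Rightarrow> bool" where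
  "strictly_northwest p q \<longleftrightarrow> fst p < fst q \<and> snd p > snd q"

definition box :: "nat \<times> nat \<Rightarrow> nat \<times> nat \<Rightarrow> (nat \<times> nat) set" where
  "box p q = {min (fst p) (fst q)..max (fst p) (fst q)} \<times> {min (snd p) (snd q)..max (snd p) (snd q)}"

definition incompatible :: "step list \<Rightarrow> nat \<times> nat \<Rightarrow> nat \<times> nat \<Rightarrow> bool" where
  "incompatible \<nu> p q \<longleftrightarrow>
     (strictly_southwest p q \<or> strictly_southwest q p) \<and> box p q \<subseteq> region \<nu>"

definition schroeder_trees :: "step list \<Rightarrow> (nat \<times> nat) set set" where
  "schroeder_trees \<nu> = {T. T \<subseteq> region \<nu> \<and>
     (\<forall>p\<in>T. \<forall>q\<in>T. \<not> incompatible \<nu> p q) \<and>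
     (0, snd (end_point \<nu>)) \<in> T \<and>
     (\<forall>y\<le>snd (end_point \<nu>). \<exists>x. (x, y) \<in> T) \<and>
     (\<forall>x\<le>fst (end_point \<nu>). \<exists>y. (x, y) \<in> T)}"

definition above_in_column :: "nat \<times> nat \<Rightarrow> nat \<times> nat \<Rightarrow> bool" where
  "above_in_column q p \<longleftrightarrow> fst q = fst p \<and> snd q > snd p"

definition left_in_row :: "nat \<times> nat \<Rightarrow> nat \<times> nat \<Rightarrow> bool" where
  "left_in_row q p \<longleftrightarrow> snd q = snd p \<and> fst q < fst p"

text \<open>\<open>is_parent T p q\<close>: the parent of \<open>p\<close> in \<open>T\<close> is \<open>q\<close>. The root has no parent, because no point
  of the region is above, to the left or northwest of it.\<close>

definition is_parent :: "(nat \<times> nat) set \<Rightarrow> nat \<times> nat \<Rightarrow> nat \<times> nat \<Rightarrow> bool" where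
  "is_parent T p q \<longleftrightarrow> p \<in> T \<and> q \<in> T \<and>
     (if \<exists>s\<in>T. above_in_column s p
      then above_in_column q p \<and> (\<forall>s\<in>T. above_in_column s p \<longrightarrow> snd q \<le> snd s)
      else if \<exists>s\<in>T. left_in_row s p
      then left_in_row q p \<and> (\<forall>s\<in>T. left_in_row s p \<longrightarrow> fst s \<le> fst q)
      else strictly_northwest q p \<and> box p q \<inter> T = {p, q})"

inductive tree_contraction ::
  "step list \<Rightarrow> (nat \<times> nat) set \<Rightarrow> (nat \<times> nat) set \<Rightarrow> bool" for \<nu> S where
  right: "q \<in> S \<Longrightarrow> \<exists>p\<in>S. above_in_column p q \<Longrightarrow> \<exists>r\<in>S. left_in_row q r
    \<Longrightarrow> tree_contraction \<nu> S (S - {q})"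
| left: "q \<in> S \<Longrightarrow> \<exists>p\<in>S. left_in_row p q \<Longrightarrow> \<exists>r\<in>S. above_in_column q r
    \<Longrightarrow> tree_contraction \<nu> S (S - {q})"
| diagonal: "is_parent S r p \<Longrightarrow> strictly_northwest p r \<Longrightarrow>
    (fst p, snd r) \<notin> S \<Longrightarrow> (fst r, snd p) \<notin> S \<Longrightarrow> S - {r} \<in> schroeder_trees \<nu>
    \<Longrightarrow> tree_contraction \<nu> S (S - {r})"

definition tree_poset :: "step list \<Rightarrow> (nat \<times> nat) set gorder" where
  "tree_poset \<nu> = poset_of_covers (schroeder_trees \<nu>) (tree_contraction \<nu>)"

text \<open>A path stays weakly above \<open>\<nu>\<close> iff its vertices do and none of its diagonal steps crosses
  \<open>\<nu>\<close>. Let \<open>h\<close> be the height of the east step of \<open>\<nu>\<close> between the columns \<open>x\<close> and \<open>x + 1\<close>. The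
  diagonal segment from \<open>(x, y)\<close> to \<open>(x + 1, y + 1)\<close> is weakly above \<open>\<nu>\<close> iff \<open>h \<le> y\<close>, that is, iff
  \<open>(x + 1, y)\<close> is in the region. This does not follow from its two end points being in the region:
  \<open>\<nu>\<close> may go from \<open>(x, y)\<close> to \<open>(x + 1, y + 1)\<close> by a north step and an east step.\<close>

definition schroeder_paths :: "step list \<Rightarrow> step list set" where
  "schroeder_paths \<nu> = {w. end_point w = end_point \<nu> \<and> vertices w \<subseteq> region \<nu> \<and>
     (\<forall>u v. w = u @ Diag # v \<longrightarrow> end_point (u @ [East]) \<in> region \<nu>)}"

definition horiz :: "step list \<Rightarrow> nat \<times> nat \<Rightarrow> nat" where
  "horiz \<nu> p = Max {k. \<forall>j\<le>k. (fst p + j, snd p) \<in> region \<nu>}"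

text \<open>On a path beginning with \<open>u @ m\<close>, the end point of \<open>u\<close> is the last lattice point before the
  end point of \<open>u @ m\<close> that has the same \<open>horiz\<close>.\<close>

definition last_same_horiz :: "step list \<Rightarrow> step list \<Rightarrow> step list \<Rightarrow> bool" where
  "last_same_horiz \<nu> u m \<longleftrightarrow> m \<noteq> [] \<and>
     horiz \<nu> (end_point u) = horiz \<nu> (end_point (u @ m)) \<and>
     (\<forall>m\<^sub>1 m\<^sub>2. m = m\<^sub>1 @ m\<^sub>2 \<and> m\<^sub>1 \<noteq> [] \<and> m\<^sub>2 \<noteq> [] \<longrightarrow>
        horiz \<nu> (end_point (u @ m\<^sub>1)) \<noteq> horiz \<nu> (end_point (u @ m)))"

text \<open>In \<open>left\<close> the point \<open>q\<close> is the end of \<open>u @ North # v\<close>, and in \<open>diagonal\<close> the point \<open>r\<close> is the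
  end of \<open>u @ North # v @ [East]\<close>. Shifting \<open>v\<close> one unit to the right is implicit, since it now
  follows a diagonal step instead of a north step.\<close>

inductive path_contraction :: "step list \<Rightarrow> step list \<Rightarrow> step list \<Rightarrow> bool" for \<nu> where
  right: "path_contraction \<nu> (u @ [East, North] @ v) (u @ [Diag] @ v)"
| left: "last_same_horiz \<nu> u (North # v)
    \<Longrightarrow> path_contraction \<nu> (u @ [North] @ v @ [East] @ z) (u @ [Diag] @ v @ z)"
| diagonal: "last_same_horiz \<nu> u (North # v @ [East])
    \<Longrightarrow> path_contraction \<nu> (u @ [North] @ v @ [East, Diag] @ z) (u @ [Diag] @ v @ [Diag] @ z)"

definition path_poset :: "step list \<Rightarrow> step list gorder" where
  "path_poset \<nu> = poset_of_covers (schroeder_paths \<nu>) (path_contraction \<nu>)"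

datatype 'a hat = Zero_hat | Elem 'a | One_hat

inductive hat_le :: "('a \<Rightarrow> 'a \<Rightarrow> bool) \<Rightarrow> 'a hat \<Rightarrow> 'a hat \<Rightarrow> bool" for R where
  "hat_le R Zero_hat y"
| "hat_le R x One_hat"
| "R x y \<Longrightarrow> hat_le R (Elem x) (Elem y)"

definition adjoin_bounds :: "'a gorder \<Rightarrow> 'a hat gorder" where
  "adjoin_bounds L = \<lparr> carrier = {Zero_hat, One_hat} \<union> Elem ` carrier L,
     eq = (=), le = hat_le (le L) \<rparr>"

definition covered_by :: "'a gorder \<Rightarrow> 'a \<Rightarrow> 'a \<Rightarrow> bool" where
  "covered_by L x y \<longleftrightarrow> x \<in> carrier L \<and> y \<in> carrier L \<and> x \<sqsubset>\<^bsub>L\<^esub> y \<and>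
     \<not> (\<exists>z\<in>carrier L. x \<sqsubset>\<^bsub>L\<^esub> z \<and> z \<sqsubset>\<^bsub>L\<^esub> y)"

definition rank_function :: "'a gorder \<Rightarrow> ('a \<Rightarrow> nat) \<Rightarrow> bool" where
  "rank_function L \<rho> \<longleftrightarrow> (\<forall>x. least L x (carrier L) \<longrightarrow> \<rho> x = 0) \<and>
     (\<forall>x y. covered_by L x y \<longrightarrow> \<rho> y = \<rho> x + 1)"

text \<open>On a nonempty finite lattice there is at most one rank function, and there is one iff all
  maximal chains have the same length.\<close>

definition eulerian_lattice :: "'a gorder \<Rightarrow> bool" where
  "eulerian_lattice L \<longleftrightarrow> lattice L \<and> finite (carrier L) \<and>
     (\<exists>\<rho>. rank_function L \<rho> \<and>
        (\<forall>x\<in>carrier L. \<forall>y\<in>carrier L. x \<sqsubset>\<^bsub>L\<^esub> y \<longrightarrow>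
           card {z \<in> \<lbrace>x..y\<rbrace>\<^bsub>L\<^esub>. even (\<rho> z)} = card {z \<in> \<lbrace>x..y\<rbrace>\<^bsub>L\<^esub>. odd (\<rho> z)}))"

definition eulerian_intervals :: "'a gorder \<Rightarrow> bool" where
  "eulerian_intervals L \<longleftrightarrow> (\<forall>x\<in>carrier L. \<forall>y\<in>carrier L. x \<sqsubseteq>\<^bsub>L\<^esub> y \<longrightarrow>
     eulerian_lattice (L\<lparr>carrier := \<lbrace>x..y\<rbrace>\<^bsub>L\<^esub>\<rparr>))"

end

theory Submission
  imports Defs
begin

text \<open>A contraction removes one point from a tree, and every point of a tree \<open>S\<close> that is missing from a
  smaller tree \<open>S'\<close> can be contracted. So the order on trees is reverse inclusion, meets are unions and
  joins are intersections whenever these are trees, and intervals of trees are Boolean.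

  Every point of a tree is leftmost in its row or topmost in its column. The points other than the
  root that are both (the diagonal points) measure how far the tree is from having the maximal
  number \<open>a + b + 1\<close> of points, and each of them allows adding a point. An interval \<open>[0, T]\<close> is
  Eulerian iff the sum of \<open>(-1) ^ card S\<close> over the trees \<open>S\<close> that contain \<open>T\<close> is \<open>(-1) ^ (a + b + 1)\<close>.
  Take the first diagonal point \<open>r\<close> of \<open>T\<close>, its parent \<open>p\<close>, and the corner above \<open>r\<close> and to the right
  of \<open>p\<close>. The trees with this corner are handled by induction, the others cancel in pairs.

  Trees correspond to paths by right flushing: reading the points row by row from the bottom, and
  from right to left in each row, each point gives a step. Removing a point then amounts to a
  contraction of the path, where the condition on \<open>horiz\<close> locates the next point below it in its
  column.\<close>

section \<open>Schroeder trees\<close>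

text \<open>Between two trees nothing topological happens, because every set between them is a tree.
  The obstacle is an interval that starts at \<open>Zero_hat\<close>: two trees need not lie in a
  common larger tree, so no single point can be added to or removed from all trees above
  \<open>T\<close>. The toggled point must therefore vary with the tree, and toggling must not
  change the choice. This is achieved by reading the choice off the column of \<open>r\<close> while
  the toggled point lies in the column of \<open>p\<close>. The sign
  \<open>(-1) ^ (a + b + 1)\<close> is the one that cancels \<open>Zero_hat\<close>: trees with
  \<open>a + b + 1\<close> points get rank 1, so trees and their cardinalities differ in sign by
  \<open>(-1) ^ (a + b)\<close>.

  On the side of paths, the reading order is chosen such that, when a point is read, every column to
  its right that meets the region in this row has already been read up to its top. The state of the
  reading is thus a set of open columns. It determines the horizontal coordinate of the path and the
  value of \<open>horiz\<close>, and it allows the next point to be recovered from the path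
  alone.\<close>

lemma end_point_Nil [simp]: "end_point [] = (0, 0)"
  by (simp add: end_point_def)

lemma end_point_append:
  "end_point (u @ v) = (fst (end_point u) + fst (end_point v), snd (end_point u) + snd (end_point v))"
  by (simp add: end_point_def)

lemma end_point_single:
  "end_point [s] = (if s = North then 0 else 1, if s = East then 0 else 1)"
  by (cases s) (auto simp: end_point_def)

lemma end_point_snoc:
  "end_point (u @ [s]) = (fst (end_point u) + (if s = North then 0 else 1),
                          snd (end_point u) + (if s = East then 0 else 1))"
  by (simp add: end_point_append end_point_single)

text \<open>A step moves at most one unit to the right, so a path skips no column.\<close>

lemma prefix_with_fst:
  "x \<le> fst (end_point w) \<Longrightarrow> \<exists>u v. w = u @ v \<and> fst (end_point u) = x"
proof (induction w rule: rev_induct)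
  case (snoc s w)
  show ?case
  proof (cases "x = fst (end_point (w @ [s]))")
    case True
    then show ?thesis by (metis append_Nil2)
  next
    case False
    with snoc.prems have "x \<le> fst (end_point w)"
      by (auto simp: end_point_snoc split: if_splits)
    with snoc.IH show ?thesis by (metis append_assoc)
  qed
qed (auto simp: exI[of _ "[]"])

definition topmost :: "(nat \<times> nat) set \<Rightarrow> nat \<times> nat \<Rightarrow> bool" where
  "topmost T p \<longleftrightarrow> p \<in> T \<and> \<not> (\<exists>s\<in>T. above_in_column s p)"

definition leftmost :: "(nat \<times> nat) set \<Rightarrow> nat \<times> nat \<Rightarrow> bool" where
  "leftmost T p \<longleftrightarrow> p \<in> T \<and> \<not> (\<exists>s\<in>T. left_in_row s p)"

lemma topmostD: "topmost T (x, y) \<Longrightarrow> (x, y') \<in> T \<Longrightarrow> y' \<le> y"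
  by (force simp: topmost_def above_in_column_def)

lemma leftmostD: "leftmost T (x, y) \<Longrightarrow> (x', y) \<in> T \<Longrightarrow> x \<le> x'"
  by (force simp: leftmost_def left_in_row_def)

lemma ex_topmost:
  assumes "finite T" "(x, y0) \<in> T"
  obtains y where "topmost T (x, y)" "y0 \<le> y"
proof -
  let ?Y = "{y. (x, y) \<in> T}"
  have "?Y \<subseteq> snd ` T" by force
  then have fin: "finite ?Y" using assms(1) finite_surj by blast
  then have "Max ?Y \<in> ?Y" using assms(2) by (intro Max_in) auto
  then have "topmost T (x, Max ?Y)"
    using fin by (auto simp: topmost_def above_in_column_def not_less)
  then show thesis using that fin assms(2) by simp
qed

lemma ex_leftmost:
  assumes "finite T" "(x0, y) \<in> T"
  obtains x where "leftmost T (x, y)" "x \<le> x0"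
proof -
  let ?X = "{x. (x, y) \<in> T}"
  have "?X \<subseteq> fst ` T" by force
  then have fin: "finite ?X" using assms(1) finite_surj by blast
  then have "Min ?X \<in> ?X" using assms(2) by (intro Min_in) auto
  then have "leftmost T (Min ?X, y)"
    using fin by (auto simp: leftmost_def left_in_row_def not_less)
  then show thesis using that fin assms(2) by simp
qed

section \<open>Geometry of the region and compatibility of points\<close>

locale nu_path =
  fixes \<nu> :: "step list" and a b :: nat
  assumes lattice_path: "lattice_path \<nu> (b, a)"
begin

lemma end_point_nu [simp]: "end_point \<nu> = (b, a)"
  using lattice_path by (simp add: lattice_path_def)

lemma region_bounds: "(x, y) \<in> region \<nu> \<Longrightarrow> x \<le> b \<and> y \<le> a"
  by (simp add: region_def)

lemma region_up: "(x, y) \<in> region \<nu> \<Longrightarrow> y \<le> y' \<Longrightarrow> y' \<le> a \<Longrightarrow> (x, y') \<in> region \<nu>"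
  by (simp add: region_def) (meson le_trans)

text \<open>On its way to column \<open>x\<close> the path \<nu> passes column \<open>x'\<close>,
  and not at a greater height because no step goes down.\<close>

lemma region_left:
  assumes "(x, y) \<in> region \<nu>" "x' \<le> x"
  shows "(x', y) \<in> region \<nu>"
proof -
  obtain u v where uv: "\<nu> = u @ v" "fst (end_point u) = x" "snd (end_point u) \<le> y"
    using assms(1) by (auto simp: region_def vertices_def) (metis fst_conv snd_conv)
  then obtain u1 u2 where "u = u1 @ u2" "fst (end_point u1) = x'"
    using prefix_with_fst assms(2) by metis
  with uv have "(x', snd (end_point u1)) \<in> vertices \<nu>" "snd (end_point u1) \<le> y"
    by (auto simp: vertices_def end_point_append)
  then show ?thesis using assms by (force simp: region_def)
qed

lemma region_col0: "y \<le> a \<Longrightarrow> (0, y) \<in> region \<nu>"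
proof -
  have "(0, 0) \<in> vertices \<nu>" unfolding vertices_def
    by (smt (verit) end_point_Nil append_Nil mem_Collect_eq)
  then show "y \<le> a \<Longrightarrow> (0, y) \<in> region \<nu>" by (auto simp: region_def)
qed

lemma region_top: "x \<le> b \<Longrightarrow> (x, a) \<in> region \<nu>"
proof -
  have "(b, a) \<in> vertices \<nu>" unfolding vertices_def
    by (smt (verit) end_point_nu append_Nil2 mem_Collect_eq)
  then have "(b, a) \<in> region \<nu>" by (auto simp: region_def)
  then show "x \<le> b \<Longrightarrow> (x, a) \<in> region \<nu>" using region_left by blast
qed

lemma finite_region: "finite (region \<nu>)"
  by (rule finite_subset[of _ "{..b} \<times> {..a}"]) (auto dest: region_bounds)

abbreviation "trees \<equiv> schroeder_trees \<nu>"

definition compatible :: "(nat \<times> nat) set \<Rightarrow> bool" where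
  "compatible T \<longleftrightarrow>
     (\<forall>x y x' y'. (x, y) \<in> T \<longrightarrow> (x', y') \<in> T \<longrightarrow> x < x' \<longrightarrow> y < y' \<longrightarrow> (x', y) \<notin> region \<nu>)"

text \<open>The region is closed under moving up and to the left, so a rectangle lies in it as soon
  as its southeast corner does. Compatibility becomes a test of one lattice point.\<close>

lemma incompatible_iff:
  assumes "(x, y) \<in> region \<nu>" "(x', y') \<in> region \<nu>"
  shows "incompatible \<nu> (x, y) (x', y') \<longleftrightarrow>
    x < x' \<and> y < y' \<and> (x', y) \<in> region \<nu> \<or> x' < x \<and> y' < y \<and> (x, y') \<in> region \<nu>"
proof -
  have *: "box p q \<subseteq> region \<nu> \<longleftrightarrow> (fst q, snd p) \<in> region \<nu>"
    if "fst p < fst q" "snd p < snd q" "p \<in> region \<nu>" "q \<in> region \<nu>" for p q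
  proof
    assume c: "(fst q, snd p) \<in> region \<nu>"
    show "box p q \<subseteq> region \<nu>"
    proof
      fix r assume "r \<in> box p q"
      then have "fst r \<le> fst q" "snd p \<le> snd r" "snd r \<le> snd q"
        using that by (auto simp: box_def min_def max_def split: if_splits)
      moreover have "snd q \<le> a" using that(4) region_bounds by (cases q) auto
      ultimately show "r \<in> region \<nu>"
        using region_up[OF c, of "snd r"] region_left[of "fst q" "snd r" "fst r"] by auto
    qed
  qed (use that in \<open>auto simp: box_def\<close>)
  have "box q p = box p q" for p q by (auto simp: box_def min.commute max.commute)
  then show ?thesis
    using *[of "(x, y)" "(x', y')"] *[of "(x', y')" "(x, y)"] assms
    by (auto simp: incompatible_def strictly_southwest_def)
qed

lemma trees_iff:
  "T \<in> trees \<longleftrightarrow> T \<subseteq> region \<nu> \<and> compatible T \<and> (0, a) \<in> T \<and>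
     (\<forall>y\<le>a. \<exists>x. (x, y) \<in> T) \<and> (\<forall>x\<le>b. \<exists>y. (x, y) \<in> T)"
proof -
  have "(\<forall>p\<in>T. \<forall>q\<in>T. \<not> incompatible \<nu> p q) \<longleftrightarrow> compatible T" if "T \<subseteq> region \<nu>"
  proof
    assume "\<forall>p\<in>T. \<forall>q\<in>T. \<not> incompatible \<nu> p q"
    then show "compatible T"
      using that incompatible_iff unfolding compatible_def by (meson subsetD)
  next
    assume c: "compatible T"
    have "\<not> incompatible \<nu> (x, y) (x', y')" if "(x, y) \<in> T" "(x', y') \<in> T" for x y x' y'
      using that c \<open>T \<subseteq> region \<nu>\<close> incompatible_iff[of x y x' y'] unfolding compatible_def by (meson subsetD)
    then show "\<forall>p\<in>T. \<forall>q\<in>T. \<not> incompatible \<nu> p q" by auto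
  qed
  then show ?thesis by (auto simp: schroeder_trees_def)
qed

lemma trees_subset: "T \<in> trees \<Longrightarrow> T \<subseteq> region \<nu>"
  by (simp add: trees_iff)

lemma finite_tree: "T \<in> trees \<Longrightarrow> finite T"
  using trees_subset finite_region finite_subset by blast

lemma finite_trees: "finite trees"
  by (rule finite_subset[of _ "Pow (region \<nu>)"]) (use trees_subset finite_region in blast)+

lemma tree_bounds: "T \<in> trees \<Longrightarrow> (x, y) \<in> T \<Longrightarrow> x \<le> b \<and> y \<le> a"
  using trees_subset region_bounds by blast

lemma compatibleD:
  "T \<in> trees \<Longrightarrow> (x, y) \<in> T \<Longrightarrow> (x', y') \<in> T \<Longrightarrow> x < x' \<Longrightarrow> y < y' \<Longrightarrow> (x', y) \<notin> region \<nu>"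
  by (auto simp: trees_iff compatible_def)

text \<open>A point above \<open>(x, y)\<close> in its column and a point to its left in its row
  would be incompatible, since \<open>(x, y)\<close> is the southeast corner of their rectangle.
  Hence the first two kinds of parent exclude each other.\<close>

lemma tree_above_left:
  assumes "T \<in> trees" "(x, y) \<in> T" "(x, y') \<in> T" "(x', y) \<in> T" "y < y'"
  shows "x \<le> x'"
  using compatibleD[of T x' y x y'] assms trees_subset[OF assms(1)] by force

lemma tree_mono:
  assumes "T \<in> trees" "T \<subseteq> U" "U \<subseteq> region \<nu>" "compatible U"
  shows "U \<in> trees"
  using assms by (simp add: trees_iff) blast

lemma compatible_subset: "compatible S \<Longrightarrow> T \<subseteq> S \<Longrightarrow> compatible T"
  unfolding compatible_def by blast

text \<open>Compatibility passes to subsets; the root and the points in all rows and columns pass to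
  supersets. This convexity is behind the meets, the joins and the Boolean intervals.\<close>

lemma tree_between:
  assumes "S \<in> trees" "T \<in> trees" "T \<subseteq> U" "U \<subseteq> S"
  shows "U \<in> trees"
  using assms(1,4) by (intro tree_mono[OF assms(2,3)]) (auto simp: trees_iff intro: compatible_subset)

lemma insert_tree:
  assumes T: "T \<in> trees" and r: "(x, y) \<in> region \<nu>"
    and sw: "\<And>x' y'. (x', y') \<in> T \<Longrightarrow> x' < x \<Longrightarrow> y' < y \<Longrightarrow> (x, y') \<notin> region \<nu>"
    and ne: "\<And>x' y'. (x', y') \<in> T \<Longrightarrow> x < x' \<Longrightarrow> y < y' \<Longrightarrow> (x', y) \<notin> region \<nu>"
  shows "insert (x, y) T \<in> trees"
proof (rule tree_mono[OF T subset_insertI])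
  show "insert (x, y) T \<subseteq> region \<nu>" using T r by (simp add: trees_iff)
  have "(x2, y1) \<notin> region \<nu>"
    if "(x1, y1) \<in> insert (x, y) T" "(x2, y2) \<in> insert (x, y) T" "x1 < x2" "y1 < y2" for x1 y1 x2 y2
    using that sw[of x1 y1] ne[of x2 y2] compatibleD[OF T, of x1 y1 x2 y2] by auto
  then show "compatible (insert (x, y) T)" unfolding compatible_def by blast
qed

text \<open>For these points \<open>is_parent\<close> reaches its last case, the parent strictly to
  the northwest. The root is left out because it has no parent.\<close>

definition diag_points :: "(nat \<times> nat) set \<Rightarrow> (nat \<times> nat) set" where
  "diag_points T = {p. topmost T p \<and> leftmost T p \<and> p \<noteq> (0, a)}"

lemma root_extremal: "T \<in> trees \<Longrightarrow> topmost T (0, a) \<and> leftmost T (0, a)"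
  using tree_bounds[of T 0]
  by (fastforce simp: topmost_def leftmost_def above_in_column_def left_in_row_def trees_iff)

lemma tree_extremal: "T \<in> trees \<Longrightarrow> p \<in> T \<Longrightarrow> topmost T p \<or> leftmost T p"
  using tree_above_left
  by (cases p) (force simp: topmost_def leftmost_def above_in_column_def left_in_row_def)

text \<open>Each of the \<open>a + 1\<close> rows has one leftmost point and each of the
  \<open>b + 1\<close> columns has one topmost point. The two families cover the tree and overlap in
  the diagonal points and the root; the root accounts for \<open>a + b + 1\<close> in place of
  \<open>a + b + 2\<close>.\<close>

lemma card_tree:
  assumes T: "T \<in> trees"
  shows "card T + card (diag_points T) = a + b + 1"
proof -
  have fin: "finite T" using T by (rule finite_tree)
  have "bij_betw snd {p. leftmost T p} {..a}"
  proof (rule bij_betw_imageI)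
    show "inj_on snd {p. leftmost T p}"
      using leftmostD by (auto simp: inj_on_def) (meson antisym leftmost_def)+
    show "snd ` {p. leftmost T p} = {..a}"
    proof (intro equalityI subsetI)
      fix y assume "y \<in> {..a}"
      then obtain x where "(x, y) \<in> T" using T by (auto simp: trees_iff)
      then show "y \<in> snd ` {p. leftmost T p}" using ex_leftmost[OF fin] by (metis image_eqI mem_Collect_eq snd_conv)
    qed (use tree_bounds[OF T] in \<open>auto simp: leftmost_def\<close>)
  qed
  moreover have "bij_betw fst {p. topmost T p} {..b}"
  proof (rule bij_betw_imageI)
    show "inj_on fst {p. topmost T p}"
      using topmostD by (auto simp: inj_on_def) (meson antisym topmost_def)+
    show "fst ` {p. topmost T p} = {..b}"
    proof (intro equalityI subsetI)
      fix x assume "x \<in> {..b}"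
      then obtain y where "(x, y) \<in> T" using T by (auto simp: trees_iff)
      then show "x \<in> fst ` {p. topmost T p}" using ex_topmost[OF fin] by (metis image_eqI mem_Collect_eq fst_conv)
    qed (use tree_bounds[OF T] in \<open>auto simp: topmost_def\<close>)
  qed
  ultimately have "card {p. leftmost T p} = a + 1" "card {p. topmost T p} = b + 1"
    by (simp_all add: bij_betw_same_card)
  moreover have "{p. leftmost T p} \<union> {p. topmost T p} = T"
    using tree_extremal[OF T] by (auto simp: leftmost_def topmost_def)
  moreover have "{p. leftmost T p} \<inter> {p. topmost T p} = insert (0, a) (diag_points T)"
    using root_extremal[OF T] by (auto simp: diag_points_def)
  moreover have "finite {p. leftmost T p}" "finite {p. topmost T p}"
    using fin by (auto simp: leftmost_def topmost_def)
  moreover have "(0, a) \<notin> diag_points T" "finite (diag_points T)"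
    using fin by (auto simp: diag_points_def topmost_def)
  ultimately show ?thesis
    using card_Un_Int[of "{p. leftmost T p}" "{p. topmost T p}"] by simp
qed

lemma ex_parent:
  assumes T: "T \<in> trees" and r: "(x, y) \<in> diag_points T"
  obtains px py where "(px, py) \<in> T" "px < x" "y < py" "box (px, py) (x, y) \<inter> T = {(px, py), (x, y)}"
proof -
  have top: "topmost T (x, y)" and left: "leftmost T (x, y)" and "(x, y) \<noteq> (0, a)" and xy: "(x, y) \<in> T"
    using r by (auto simp: diag_points_def topmost_def)
  have root: "(0, a) \<in> T" using T by (simp add: trees_iff)
  let ?N = "{(px, py) \<in> T. px < x \<and> y < py}"
  have "(0, a) \<in> ?N"
    using root xy topmostD[OF top, of a] leftmostD[OF left, of 0] \<open>(x, y) \<noteq> (0, a)\<close> tree_bounds[OF T xy]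
    by (cases "x = 0"; cases "y = a") auto
  moreover have fin: "finite ?N" using finite_tree[OF T] by (rule rev_finite_subset) auto
  \<comment> \<open>Minimizing \<open>x - px + py\<close> makes the rectangle empty: another point
    of it that avoids column \<open>x\<close> and row \<open>y\<close> would have a smaller value.
    The subtraction is exact because \<open>px < x\<close> on \<open>?N\<close>.\<close>
  ultimately obtain p where p: "p \<in> ?N"
    and min: "\<And>q. q \<in> ?N \<Longrightarrow> (\<lambda>(px, py). x - px + py) p \<le> (\<lambda>(px, py). x - px + py) q"
    using arg_min_if_finite[of ?N "\<lambda>(px, py). x - px + py"]
    by (metis (no_types, lifting) empty_iff not_le)
  obtain px py where pxy: "p = (px, py)" by fastforce
  have "q \<in> {(px, py), (x, y)}" if q: "q \<in> box (px, py) (x, y)" "q \<in> T" for q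
  proof -
    obtain qx qy where qxy: "q = (qx, qy)" by fastforce
    have b: "px \<le> qx" "qx \<le> x" "y \<le> qy" "qy \<le> py"
      using q p by (auto simp: box_def qxy pxy)
    show ?thesis
    proof (cases "qx = x \<or> qy = y")
      case True
      then show ?thesis
        using topmostD[OF top, of qy] leftmostD[OF left, of qx] b q(2) qxy by auto
    next
      case False
      then have "q \<in> ?N" using b q qxy by auto
      from min[OF this] show ?thesis using b False by (auto simp: pxy qxy)
    qed
  qed
  then have "box (px, py) (x, y) \<inter> T = {(px, py), (x, y)}"
    using p xy by (auto simp: pxy box_def)
  then show thesis using that p by (auto simp: pxy)
qed

lemma box_commute: "box q p = box p q"
  by (simp add: box_def min.commute max.commute)

lemma box_empty:
  assumes "box (px, py) (x, y) \<inter> T = {(px, py), (x, y)}" "(sx, sy) \<in> T"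
    "px \<le> sx" "sx \<le> x" "y \<le> sy" "sy \<le> py"
  shows "(sx, sy) = (px, py) \<or> (sx, sy) = (x, y)"
proof -
  have "(sx, sy) \<in> box (px, py) (x, y) \<inter> T" using assms(2-) by (auto simp: box_def)
  then show ?thesis unfolding assms(1) by simp
qed

section \<open>Contractions as removals of one point\<close>

lemma contraction_remove:
  "tree_contraction \<nu> S S' \<Longrightarrow> \<exists>q\<in>S. S' = S - {q}"
  by (induction rule: tree_contraction.induct) (auto simp: is_parent_def)

text \<open>The row and the column of \<open>q\<close> must keep another point. If \<open>q\<close>
  is not topmost, its row neighbour can only lie to the right, which allows a right contraction. If
  \<open>q\<close> is topmost, its column neighbour lies below, which allows a left contraction
  unless \<open>q\<close> is leftmost too. In that case the empty rectangle from
  \<open>ex_parent\<close> supplies the parent and the absence of the other two corners.\<close>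

lemma remove_contraction:
  assumes S: "S \<in> trees" and S': "S - {q} \<in> trees" and q: "q \<in> S"
  shows "tree_contraction \<nu> S (S - {q})"
proof -
  obtain x y where qxy: "q = (x, y)" by fastforce
  have "x \<le> b" "y \<le> a" using tree_bounds[OF S] q qxy by auto
  then obtain x' y' where x': "(x', y) \<in> S - {q}" and y': "(x, y') \<in> S - {q}"
    using S' unfolding trees_iff by blast
  have root: "q \<noteq> (0, a)" using S' by (auto simp: trees_iff)
  show ?thesis
  proof (cases "topmost S q")
    case False
    then obtain y'' where above: "(x, y'') \<in> S" "y < y''"
      using q by (auto simp: topmost_def above_in_column_def qxy)
    have "x \<le> x'" using tree_above_left[OF S _ above(1)] q x' above qxy by auto
    then have "x < x'" using x' qxy by (cases "x = x'") auto
    then show ?thesis using q x' above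
      by (intro tree_contraction.right) (force simp: qxy above_in_column_def left_in_row_def)+
  next
    case True
    then have "y' < y"
      using topmostD[of S x y y'] y' qxy by (cases "y' = y") auto
    then have below: "\<exists>r\<in>S. above_in_column q r"
      using y' by (force simp: above_in_column_def qxy)
    show ?thesis
    proof (cases "leftmost S q")
      case False
      then show ?thesis using below q
        by (intro tree_contraction.left) (auto simp: leftmost_def)
    next
      case left: True
      then have diag: "(x, y) \<in> diag_points S" using True root by (simp add: diag_points_def qxy)
      then obtain px py where p: "(px, py) \<in> S" "px < x" "y < py"
        and box: "box (px, py) (x, y) \<inter> S = {(px, py), (x, y)}"
        using ex_parent[OF S] by blast
      have np: "\<not> (\<exists>s\<in>S. above_in_column s (x, y))" "\<not> (\<exists>s\<in>S. left_in_row s (x, y))"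
        using True left by (simp_all add: topmost_def leftmost_def qxy)
      have nw: "strictly_northwest (px, py) (x, y)" using p by (simp add: strictly_northwest_def)
      have "is_parent S (x, y) (px, py)"
        unfolding is_parent_def if_not_P[OF np(1)] if_not_P[OF np(2)]
        using box p q nw qxy by (auto simp: box_commute)
      moreover have "(px, y) \<notin> S" "(x, py) \<notin> S"
        using box_empty[OF box, of px y] box_empty[OF box, of x py] p by auto
      ultimately have "tree_contraction \<nu> S (S - {(x, y)})"
        using nw S' qxy by (intro tree_contraction.diagonal[of S "(x, y)" "(px, py)"]) simp_all
      then show ?thesis by (simp add: qxy)
    qed
  qed
qed

lemma tree_contraction_iff:
  assumes "S \<in> trees" "S' \<in> trees"
  shows "tree_contraction \<nu> S S' \<longleftrightarrow> (\<exists>q\<in>S. S' = S - {q})"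
  using assms remove_contraction contraction_remove by metis

end

section \<open>Euler characteristics\<close>

lemma sum_sign_reversing_involution:
  fixes f :: "'a \<Rightarrow> int"
  assumes "\<And>x. x \<in> A \<Longrightarrow> \<phi> x \<in> A" "\<And>x. x \<in> A \<Longrightarrow> \<phi> (\<phi> x) = x" "\<And>x. x \<in> A \<Longrightarrow> f (\<phi> x) = - f x"
  shows "sum f A = 0"
proof -
  have "sum f A = (\<Sum>x\<in>A. - f x)"
    using assms by (intro sum.reindex_bij_witness[of _ \<phi> \<phi>]) auto
  then show ?thesis by (simp add: sum_negf)
qed

definition toggle :: "'a \<Rightarrow> 'a set \<Rightarrow> 'a set" where
  "toggle c S = (if c \<in> S then S - {c} else insert c S)"

lemma toggle_toggle [simp]: "toggle c (toggle c S) = S"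
  by (auto simp: toggle_def)

lemma sign_toggle: "finite S \<Longrightarrow> (-1::int) ^ card (toggle c S) = - ((-1) ^ card S)"
  by (cases "card S") (auto simp: toggle_def card_Diff_singleton card_insert_if)

context nu_path
begin

text \<open>The corner is above \<open>(x, y)\<close> and hence in the region. A point incompatible
  with it would be incompatible with \<open>(x, y)\<close> or with its parent, or lie to the left of
  \<open>(x, y)\<close> in the row, or lie in the empty rectangle.\<close>

lemma insert_corner:
  assumes T: "T \<in> trees" and r: "(x, y) \<in> diag_points T"
    and p: "(px, py) \<in> T" "px < x" "y < py" "box (px, py) (x, y) \<inter> T = {(px, py), (x, y)}"
  shows "insert (x, py) T \<in> trees" "(x, py) \<notin> T"
proof -
  have top: "topmost T (x, y)" and left: "leftmost T (x, y)" and xy: "(x, y) \<in> T"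
    using r by (auto simp: diag_points_def topmost_def)
  have reg: "(x, py) \<in> region \<nu>"
    using region_up[of x y py] trees_subset[OF T] xy p tree_bounds[OF T p(1)] by auto
  show "insert (x, py) T \<in> trees"
  proof (rule insert_tree[OF T reg])
    fix x' y' assume s: "(x', y') \<in> T" "x' < x" "y' < py"
    show "(x, y') \<notin> region \<nu>"
    proof
      assume c: "(x, y') \<in> region \<nu>"
      consider "y' < y" | "y' = y" | "y < y'" "x' < px" | "y < y'" "px \<le> x'" by linarith
      then show False
      proof cases
        case 1 then show ?thesis using compatibleD[OF T s(1) xy] s c by auto
      next
        case 2 then show ?thesis using leftmostD[OF left, of x'] s by auto
      next
        case 3
        then show ?thesis
          using compatibleD[OF T s(1) p(1)] region_left[OF c, of px] s p by auto
      next
        case 4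
        then show ?thesis using box_empty[OF p(4) s(1)] s by auto
      qed
    qed
  next
    fix x' y' assume s: "(x', y') \<in> T" "x < x'" "py < y'"
    then show "(x', py) \<notin> region \<nu>" using compatibleD[OF T p(1) s(1)] p by auto
  qed
  show "(x, py) \<notin> T" using topmostD[OF top, of py] p by auto
qed

text \<open>Trees that contain the corner \<open>(x, py)\<close> are handled by induction. The others cancel in
  pairs: if \<open>(x, h)\<close> is the topmost point of \<open>S\<close> in the column of \<open>(x, y)\<close>, then \<open>(px, h)\<close> is
  compatible with \<open>S\<close>. This uses that \<open>(x, y)\<close> is the first diagonal point.\<close>

lemma sum_sign_without_corner:
  assumes T: "T \<in> trees" and r: "(x, y) \<in> diag_points T"
    and first: "\<And>x' y'. (x', y') \<in> diag_points T \<Longrightarrow> x \<le> x'"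
    and p: "(px, py) \<in> T" "px < x" "y < py" "box (px, py) (x, y) \<inter> T = {(px, py), (x, y)}"
  shows "(\<Sum>S | S \<in> trees \<and> T \<subseteq> S \<and> (x, py) \<notin> S. (-1::int) ^ card S) = 0" (is "sum _ ?A = 0")
proof (rule sum_sign_reversing_involution)
  have xy: "(x, y) \<in> T" using r by (auto simp: diag_points_def topmost_def)
  have reg: "(x, py) \<in> region \<nu>"
    using region_up[of x y py] trees_subset[OF T] xy p tree_bounds[OF T p(1)] by auto
  \<comment> \<open>\<open>h S\<close> only depends on column \<open>x\<close>, and the toggled
    point is in column \<open>px < x\<close>. So toggling keeps \<open>h\<close>, which makes
    \<open>\<phi>\<close> an involution.\<close>
  define h where "h S = Max {z. (x, z) \<in> S}" for S :: "(nat \<times> nat) set"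
  define \<phi> where "\<phi> S = toggle (px, h S) S" for S
  have h_phi: "h (\<phi> S) = h S" for S
    using p(2) by (auto simp: h_def \<phi>_def toggle_def intro: arg_cong[where f = Max])
  then show "\<phi> (\<phi> S) = S" for S by (simp add: \<phi>_def[of "\<phi> S"]) (simp add: \<phi>_def)
  show "(-1::int) ^ card (\<phi> S) = - ((-1) ^ card S)" if "S \<in> ?A" for S
    using that finite_tree by (simp add: \<phi>_def sign_toggle)
  fix S assume "S \<in> ?A"
  then have S: "S \<in> trees" and TS: "T \<subseteq> S" and c: "(x, py) \<notin> S" by auto
  have xyS: "(x, y) \<in> S" and pS: "(px, py) \<in> S" using xy TS p by auto
  obtain h' where h': "topmost S (x, h')" "y \<le> h'" using ex_topmost[OF finite_tree[OF S] xyS] .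
  have "{z. (x, z) \<in> S} \<subseteq> snd ` S" by force
  then have "finite {z. (x, z) \<in> S}" using finite_tree[OF S] finite_surj by blast
  then have "h S = h'" unfolding h_def
    using h' topmostD[OF h'(1)] by (intro Max_eqI) (auto simp: topmost_def)
  with h' have h: "topmost S (x, h S)" "y \<le> h S" "(x, h S) \<in> S" by (auto simp: topmost_def)
  have "\<not> py < h S"
    using compatibleD[OF S pS h(3)] reg p by auto
  moreover have "h S \<noteq> py" using h c by auto
  ultimately have h_py: "h S < py" by simp
  \<comment> \<open>Toggling must never delete a point of \<open>T\<close>; the candidate lies in
    the empty rectangle and differs from its two corners in \<open>T\<close>.\<close>
  have notT: "(px, h S) \<notin> T" using box_empty[OF p(4), of px "h S"] p h h_py by auto
  have "insert (px, h S) S \<in> trees"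
  proof (rule insert_tree[OF S])
    show "(px, h S) \<in> region \<nu>"
      using region_left[of x "h S" px] trees_subset[OF S] h p by auto
  next
    fix x' y' assume s: "(x', y') \<in> S" "x' < px" "y' < h S"
    then show "(px, y') \<notin> region \<nu>" using compatibleD[OF S s(1) pS] h_py by auto
  next
    fix x' y' assume s: "(x', y') \<in> S" "px < x'" "h S < y'"
    show "(x', h S) \<notin> region \<nu>"
    proof
      assume c': "(x', h S) \<in> region \<nu>"
      \<comment> \<open>Here the choice of the first diagonal point is used. The topmost point
        \<open>(x', t)\<close> of \<open>T\<close> in this column lies below the rectangle. As
        \<open>x' < x\<close> it is not diagonal, so \<open>T\<close> has a point to its left in row
        \<open>t\<close>, and that point is incompatible with \<open>(x', y')\<close>.\<close>
      have between: False if "x' < x" "y' \<le> py"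
      proof -
        obtain t0 where "(x', t0) \<in> T" using T tree_bounds[OF S s(1)] by (auto simp: trees_iff)
        then obtain t where t: "topmost T (x', t)" "(x', t) \<in> T"
          using ex_topmost[OF finite_tree[OF T]] by (metis topmost_def)
        have "(x', py) \<in> region \<nu>" using region_left[OF reg] that by simp
        then have "\<not> py < t" using compatibleD[OF T p(1) t(2)] s by auto
        then have "t < y" using box_empty[OF p(4) t(2)] s that by force
        have "(x', t) \<notin> diag_points T" using first[of x' t] that by auto
        then have "\<not> leftmost T (x', t)" using t s by (auto simp: diag_points_def)
        then obtain l where l: "(l, t) \<in> T" "l < x'"
          using t by (auto simp: leftmost_def left_in_row_def)
        then have "(x', t) \<notin> region \<nu>"
          using compatibleD[OF S _ s(1), of l t] TS \<open>t < y\<close> h s by auto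
        then show False using t trees_subset[OF T] by auto
      qed
      consider "x < x'" | "x' = x" | "x' < x" "py < y'" | "x' < x" "y' \<le> py" by linarith
      then show False
      proof cases
        case 1 then show ?thesis using compatibleD[OF S h(3) s(1)] s c' by auto
      next
        case 2 then show ?thesis using topmostD[OF h(1), of y'] s by auto
      next
        case 3
        then show ?thesis using compatibleD[OF S pS s(1)] region_left[OF reg, of x'] s by auto
      qed (rule between)
    qed
  qed
  moreover have "S - {(px, h S)} \<in> trees"
    by (rule tree_between[OF S T]) (use TS notT in auto)
  ultimately show "\<phi> S \<in> ?A"
    using TS c notT p(2) by (auto simp: \<phi>_def toggle_def)
qed

lemma sum_sign_above_tree:
  assumes "T \<in> trees"
  shows "(\<Sum>S | S \<in> trees \<and> T \<subseteq> S. (-1::int) ^ card S) = (-1) ^ (a + b + 1)"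
  using assms
proof (induction "card (diag_points T)" arbitrary: T rule: less_induct)
  case less
  note T = less.prems
  show ?case
  proof (cases "diag_points T = {}")
    case True
    then have card_T: "card T = a + b + 1" using card_tree[OF T] by simp
    have "S = T" if "S \<in> trees" "T \<subseteq> S" for S
    proof -
      have "card S \<le> card T" using card_tree[OF that(1)] card_T by simp
      with card_seteq[OF finite_tree[OF that(1)] that(2)] show ?thesis by simp
    qed
    then have "{S. S \<in> trees \<and> T \<subseteq> S} = {T}" using T by auto
    then show ?thesis using card_T by simp
  next
    case False
    then obtain x y where r: "(x, y) \<in> diag_points T"
      and first: "\<And>x' y'. (x', y') \<in> diag_points T \<Longrightarrow> x \<le> x'"
      using ex_has_least_nat[of "\<lambda>q. q \<in> diag_points T" _ fst] by fastforce
    obtain px py where p: "(px, py) \<in> T" "px < x" "y < py"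
      "box (px, py) (x, y) \<inter> T = {(px, py), (x, y)}"
      using ex_parent[OF T r] .
    let ?c = "(x, py)"
    have c: "insert ?c T \<in> trees" "?c \<notin> T" using insert_corner[OF T r p] by auto
    \<comment> \<open>The total in \<open>card_tree\<close> is constant, so one more point means one
      diagonal point less.\<close>
    have "card (diag_points (insert ?c T)) < card (diag_points T)"
      using card_tree[OF T] card_tree[OF c(1)] c(2) finite_tree[OF T] by simp
    from less.hyps[OF this c(1)]
    have with_c: "(\<Sum>S | S \<in> trees \<and> insert ?c T \<subseteq> S. (-1::int) ^ card S) = (-1) ^ (a + b + 1)" .
    have "{S. S \<in> trees \<and> T \<subseteq> S} =
      {S. S \<in> trees \<and> insert ?c T \<subseteq> S} \<union> {S. S \<in> trees \<and> T \<subseteq> S \<and> ?c \<notin> S}" by auto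
    also have "(\<Sum>S\<in>\<dots>. (-1::int) ^ card S) =
      (\<Sum>S | S \<in> trees \<and> insert ?c T \<subseteq> S. (-1) ^ card S) +
      (\<Sum>S | S \<in> trees \<and> T \<subseteq> S \<and> ?c \<notin> S. (-1) ^ card S)"
      using finite_trees by (intro sum.union_disjoint) auto
    also have "(\<Sum>S | S \<in> trees \<and> T \<subseteq> S \<and> ?c \<notin> S. (-1::int) ^ card S) = 0"
      by (rule sum_sign_without_corner[OF T r _ p]) (rule first)
    finally show ?thesis using with_c by simp
  qed
qed

text \<open>A missing point shows up as a diagonal point, whose corner can be added. This is what
  keeps smaller trees from covering \<open>Zero_hat\<close>.\<close>

lemma ex_maximal_tree:
  assumes "T \<in> trees" "card T < a + b + 1"
  shows "\<exists>U\<in>trees. T \<subset> U"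
proof -
  obtain x y where r: "(x, y) \<in> diag_points T"
    using card_tree[OF assms(1)] assms(2) by (cases "diag_points T = {}") auto
  obtain px py where p: "(px, py) \<in> T" "px < x" "y < py"
    "box (px, py) (x, y) \<inter> T = {(px, py), (x, y)}"
    using ex_parent[OF assms(1) r] .
  show ?thesis using insert_corner[OF assms(1) r p] by blast
qed

end

section \<open>Posets modelled on Schroeder trees\<close>

lemma lattice_interval:
  fixes L :: "'a gorder"
  assumes L: "lattice L" and u: "u \<in> carrier L" and v: "v \<in> carrier L"
  shows "lattice (L\<lparr>carrier := \<lbrace>u..v\<rbrace>\<^bsub>L\<^esub>\<rparr>)" (is "lattice ?I")
proof -
  interpret L: lattice L by (fact L)
  have I: "z \<in> \<lbrace>u..v\<rbrace>\<^bsub>L\<^esub> \<longleftrightarrow> z \<in> carrier L \<and> u \<sqsubseteq>\<^bsub>L\<^esub> z \<and> z \<sqsubseteq>\<^bsub>L\<^esub> v" for z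
    by (simp add: at_least_at_most_def)
  show ?thesis
  proof (unfold_locales)
    fix x y assume "x \<in> carrier ?I" "y \<in> carrier ?I"
    then have xy: "x \<in> carrier L" "u \<sqsubseteq>\<^bsub>L\<^esub> x" "x \<sqsubseteq>\<^bsub>L\<^esub> v" "y \<in> carrier L" "u \<sqsubseteq>\<^bsub>L\<^esub> y" "y \<sqsubseteq>\<^bsub>L\<^esub> v"
      by (auto simp: I)
    have "u \<sqsubseteq>\<^bsub>L\<^esub> x \<squnion>\<^bsub>L\<^esub> y" using L.le_trans[OF xy(2) L.join_left] xy u by simp
    then have "least ?I (x \<squnion>\<^bsub>L\<^esub> y) (Upper ?I {x, y})"
      using xy v by (intro least_UpperI) (auto simp: I Upper_def L.join_left L.join_right L.join_le)
    then show "\<exists>s. least ?I s (Upper ?I {x, y})" ..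
    have "x \<sqinter>\<^bsub>L\<^esub> y \<sqsubseteq>\<^bsub>L\<^esub> v" using L.le_trans[OF L.meet_left xy(3)] xy v by simp
    then have "greatest ?I (x \<sqinter>\<^bsub>L\<^esub> y) (Lower ?I {x, y})"
      using xy u by (intro greatest_LowerI) (auto simp: I Lower_def L.meet_left L.meet_right L.meet_le)
    then show "\<exists>s. greatest ?I s (Lower ?I {x, y})" ..
  qed (auto simp: I L.eq_is_equal intro: L.le_trans L.le_antisym)
qed

lemma card_even_odd_iff_sum:
  assumes "finite A"
  shows "card {z\<in>A. even (\<rho> z)} = card {z\<in>A. odd (\<rho> z)} \<longleftrightarrow> (\<Sum>z\<in>A. (-1::int) ^ \<rho> z) = 0"
proof -
  have "(\<Sum>z\<in>A. (-1::int) ^ \<rho> z) =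
      (\<Sum>z\<in>{z\<in>A. even (\<rho> z)}. (-1) ^ \<rho> z) + (\<Sum>z\<in>{z\<in>A. odd (\<rho> z)}. (-1) ^ \<rho> z)"
    using assms by (subst sum.union_disjoint[symmetric]) (auto intro: arg_cong[where f = "sum _"])
  also have "\<dots> = int (card {z\<in>A. even (\<rho> z)}) - int (card {z\<in>A. odd (\<rho> z)})" by simp
  finally show ?thesis by linarith
qed

text \<open>The order-theoretic part is done once for both posets: \<open>g\<close> is the identity
  for trees and \<open>tree_of_path\<close> for paths. Single contractions are described only inside
  \<open>A\<close>, in agreement with \<open>poset_of_covers\<close>.\<close>

locale tree_model = nu_path +
  fixes A :: "'c set" and R :: "'c \<Rightarrow> 'c \<Rightarrow> bool" and g :: "'c \<Rightarrow> (nat \<times> nat) set"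
  assumes bij: "bij_betw g A trees"
    and cover_iff: "x \<in> A \<Longrightarrow> y \<in> A \<Longrightarrow> R x y \<longleftrightarrow> (\<exists>q\<in>g x. g y = g x - {q})"
begin

lemma g_tree: "x \<in> A \<Longrightarrow> g x \<in> trees"
  using bij bij_betwE by blast

lemma g_inj: "x \<in> A \<Longrightarrow> y \<in> A \<Longrightarrow> g x = g y \<longleftrightarrow> x = y"
  using bij by (auto simp: bij_betw_def inj_on_def)

lemma g_surj: "T \<in> trees \<Longrightarrow> \<exists>x\<in>A. g x = T"
  using bij by (metis bij_betw_imp_surj_on imageE)

lemma remove_ex:
  assumes "x \<in> A" "y \<in> A" "q \<in> g x" "q \<notin> g y" "g y \<subseteq> g x"
  obtains z where "z \<in> A" "g z = g x - {q}" "g y \<subseteq> g z"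
proof -
  have "g x - {q} \<in> trees"
    by (rule tree_between[OF g_tree[of x] g_tree[of y]]) (use assms in auto)
  then obtain z where "z \<in> A" "g z = g x - {q}" using g_surj by auto
  then show thesis using that[of z] assms by blast
qed

abbreviation "P \<equiv> poset_of_covers A R"
abbreviation "H \<equiv> adjoin_bounds P"

text \<open>The points of \<open>g x - g y\<close> can be removed one at a time in any order, since
  every intermediate set lies between two trees.\<close>

lemma le_P:
  assumes "x \<in> A" "y \<in> A"
  shows "x \<sqsubseteq>\<^bsub>P\<^esub> y \<longleftrightarrow> g y \<subseteq> g x"
proof
  have "(\<lambda>x y. x \<in> A \<and> y \<in> A \<and> R x y)\<^sup>*\<^sup>* x y \<Longrightarrow> g y \<subseteq> g x"
    by (induction rule: rtranclp_induct) (use cover_iff in blast)+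
  then show "x \<sqsubseteq>\<^bsub>P\<^esub> y \<Longrightarrow> g y \<subseteq> g x" by (simp add: poset_of_covers_def)
  assume "g y \<subseteq> g x"
  with assms have "(\<lambda>x y. x \<in> A \<and> y \<in> A \<and> R x y)\<^sup>*\<^sup>* x y"
  proof (induction "card (g x)" arbitrary: x rule: less_induct)
    case less
    show ?case
    proof (cases "g x = g y")
      case True
      then show ?thesis using less.prems g_inj by auto
    next
      case False
      then obtain q where q: "q \<in> g x" "q \<notin> g y" using less.prems by auto
      then obtain z where z: "z \<in> A" "g z = g x - {q}" "g y \<subseteq> g z"
        using remove_ex less.prems by metis
      have "card (g z) < card (g x)"
        unfolding z(2) by (rule card_Diff1_less[OF finite_tree[OF g_tree[OF less.prems(1)]] q(1)])
      then have "(\<lambda>x y. x \<in> A \<and> y \<in> A \<and> R x y)\<^sup>*\<^sup>* z y"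
        using less.hyps z(1,3) less.prems(2) by simp
      moreover have "R x z" using cover_iff[OF less.prems(1) z(1)] z(2) q(1) by blast
      ultimately show ?thesis
        using less.prems(1) z(1) converse_rtranclp_into_rtranclp[of "\<lambda>x y. x \<in> A \<and> y \<in> A \<and> R x y" x z y]
        by simp
    qed
  qed
  then show "x \<sqsubseteq>\<^bsub>P\<^esub> y" by (simp add: poset_of_covers_def)
qed

section \<open>The lattice property\<close>

lemma carrier_H: "carrier H = {Zero_hat, One_hat} \<union> Elem ` A"
  by (simp add: adjoin_bounds_def poset_of_covers_def)

lemma eq_H [simp]: "(.=\<^bsub>H\<^esub>) = (=)"
  by (simp add: adjoin_bounds_def)

lemma le_H [simp]:
  "Zero_hat \<sqsubseteq>\<^bsub>H\<^esub> X" "X \<sqsubseteq>\<^bsub>H\<^esub> One_hat"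
  "One_hat \<sqsubseteq>\<^bsub>H\<^esub> X \<longleftrightarrow> X = One_hat" "X \<sqsubseteq>\<^bsub>H\<^esub> Zero_hat \<longleftrightarrow> X = Zero_hat"
  "x \<in> A \<Longrightarrow> y \<in> A \<Longrightarrow> Elem x \<sqsubseteq>\<^bsub>H\<^esub> Elem y \<longleftrightarrow> g y \<subseteq> g x"
  using le_P by (auto simp: adjoin_bounds_def intro: hat_le.intros elim: hat_le.cases)

lemma partial_order_H: "partial_order H"
proof unfold_locales
  fix X Y Z
  show "X \<sqsubseteq>\<^bsub>H\<^esub> Z" if "X \<sqsubseteq>\<^bsub>H\<^esub> Y" "Y \<sqsubseteq>\<^bsub>H\<^esub> Z" "X \<in> carrier H" "Y \<in> carrier H" "Z \<in> carrier H"
    using that by (auto simp: carrier_H)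
  show "X .=\<^bsub>H\<^esub> Y" if "X \<sqsubseteq>\<^bsub>H\<^esub> Y" "Y \<sqsubseteq>\<^bsub>H\<^esub> X" "X \<in> carrier H" "Y \<in> carrier H"
    using that g_inj by (auto simp: carrier_H)
qed (auto simp: carrier_H)

text \<open>If some tree lies in both \<open>g x\<close> and \<open>g y\<close>, their intersection
  is between this tree and \<open>g x\<close>, hence a tree and the join. Otherwise
  \<open>One_hat\<close> is the only upper bound.\<close>

lemma ex_sup:
  assumes "X \<in> carrier H" "Y \<in> carrier H"
  shows "\<exists>s. least H s (Upper H {X, Y})"
proof -
  interpret partial_order H by (rule partial_order_H)
  consider "X \<sqsubseteq>\<^bsub>H\<^esub> Y" | "Y \<sqsubseteq>\<^bsub>H\<^esub> X" | x y where "X = Elem x" "Y = Elem y" "x \<in> A" "y \<in> A"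
    using assms by (auto simp: carrier_H)
  then show ?thesis
  proof cases
    case 1
    then have "least H Y (Upper H {X, Y})" using assms by (intro least_UpperI) auto
    then show ?thesis ..
  next
    case 2
    then have "least H X (Upper H {X, Y})" using assms by (intro least_UpperI) auto
    then show ?thesis ..
  next
    case 3
    have bound: "g x \<inter> g y \<in> trees \<and> g z \<subseteq> g x \<inter> g y" if "Elem z \<in> Upper H {X, Y}" for z
    proof -
      have "z \<in> A" using that Upper_closed[of H] by (auto simp: carrier_H)
      have "Elem x \<sqsubseteq>\<^bsub>H\<^esub> Elem z" "Elem y \<sqsubseteq>\<^bsub>H\<^esub> Elem z"
        using that 3 assms by (auto simp: Upper_def)
      then have z: "g z \<subseteq> g x \<inter> g y" using 3 \<open>z \<in> A\<close> by simp
      have "g x \<inter> g y \<in> trees"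
        by (rule tree_between[OF g_tree g_tree]) (use 3 \<open>z \<in> A\<close> z in auto)
      with z show ?thesis by simp
    qed
    have zero: "Zero_hat \<notin> Upper H {X, Y}" using 3 assms by (auto simp: Upper_def)
    show ?thesis
    proof (cases "g x \<inter> g y \<in> trees")
      case True
      then obtain w where w: "w \<in> A" "g w = g x \<inter> g y" using g_surj by auto
      have "Elem w \<sqsubseteq>\<^bsub>H\<^esub> Z" if "Z \<in> Upper H {X, Y}" for Z
      proof (cases Z)
        case (Elem z)
        then have "z \<in> A" using that Upper_closed[of H] by (auto simp: carrier_H)
        with w bound that Elem show ?thesis by simp
      qed (use that zero in auto)
      then have "least H (Elem w) (Upper H {X, Y})"
        using assms 3 w by (intro least_UpperI) (auto simp: carrier_H)
      then show ?thesis ..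
    next
      case False
      then have "One_hat \<sqsubseteq>\<^bsub>H\<^esub> Z" if "Z \<in> Upper H {X, Y}" for Z
        using that zero bound by (cases Z) auto
      then have "least H One_hat (Upper H {X, Y})"
        using assms by (intro least_UpperI) (auto simp: carrier_H)
      then show ?thesis ..
    qed
  qed
qed

text \<open>Dually, the union is a tree as soon as some tree contains both \<open>g x\<close> and
  \<open>g y\<close>; otherwise \<open>Zero_hat\<close> is the only lower bound.\<close>

lemma ex_inf:
  assumes "X \<in> carrier H" "Y \<in> carrier H"
  shows "\<exists>s. greatest H s (Lower H {X, Y})"
proof -
  interpret partial_order H by (rule partial_order_H)
  consider "X \<sqsubseteq>\<^bsub>H\<^esub> Y" | "Y \<sqsubseteq>\<^bsub>H\<^esub> X" | x y where "X = Elem x" "Y = Elem y" "x \<in> A" "y \<in> A"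
    using assms by (auto simp: carrier_H)
  then show ?thesis
  proof cases
    case 1
    then have "greatest H X (Lower H {X, Y})" using assms by (intro greatest_LowerI) auto
    then show ?thesis ..
  next
    case 2
    then have "greatest H Y (Lower H {X, Y})" using assms by (intro greatest_LowerI) auto
    then show ?thesis ..
  next
    case 3
    have bound: "g x \<union> g y \<in> trees \<and> g x \<union> g y \<subseteq> g z" if "Elem z \<in> Lower H {X, Y}" for z
    proof -
      have "z \<in> A" using that Lower_closed[of H] by (auto simp: carrier_H)
      have "Elem z \<sqsubseteq>\<^bsub>H\<^esub> Elem x" "Elem z \<sqsubseteq>\<^bsub>H\<^esub> Elem y"
        using that 3 assms by (auto simp: Lower_def)
      then have z: "g x \<union> g y \<subseteq> g z" using 3 \<open>z \<in> A\<close> by simp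
      have "g x \<union> g y \<in> trees"
        by (rule tree_between[OF g_tree[of z] g_tree[of x]]) (use 3 \<open>z \<in> A\<close> z in auto)
      with z show ?thesis by simp
    qed
    have one: "One_hat \<notin> Lower H {X, Y}" using 3 assms by (auto simp: Lower_def)
    show ?thesis
    proof (cases "g x \<union> g y \<in> trees")
      case True
      then obtain w where w: "w \<in> A" "g w = g x \<union> g y" using g_surj by auto
      have "Z \<sqsubseteq>\<^bsub>H\<^esub> Elem w" if "Z \<in> Lower H {X, Y}" for Z
      proof (cases Z)
        case (Elem z)
        then have "z \<in> A" using that Lower_closed[of H] by (auto simp: carrier_H)
        with w bound that Elem show ?thesis by simp
      qed (use that one in auto)
      then have "greatest H (Elem w) (Lower H {X, Y})"
        using assms 3 w by (intro greatest_LowerI) (auto simp: carrier_H)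
      then show ?thesis ..
    next
      case False
      then have "Z \<sqsubseteq>\<^bsub>H\<^esub> Zero_hat" if "Z \<in> Lower H {X, Y}" for Z
        using that one bound by (cases Z) auto
      then have "greatest H Zero_hat (Lower H {X, Y})"
        using assms by (intro greatest_LowerI) (auto simp: carrier_H)
      then show ?thesis ..
    qed
  qed
qed

lemma lattice_H: "lattice H"
  using partial_order_H ex_sup ex_inf
  by (simp add: lattice_def upper_semilattice_def lower_semilattice_def
      upper_semilattice_axioms_def lower_semilattice_axioms_def)

text \<open>Trees with \<open>a + b + 1\<close> points are the atoms of \<open>H\<close>. The value at \<open>One_hat\<close> is irrelevant.\<close>

fun rank :: "'c hat \<Rightarrow> nat" where
  "rank Zero_hat = 0"
| "rank (Elem w) = a + b + 2 - card (g w)"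
| "rank One_hat = 0"

lemma card_g_le: "x \<in> A \<Longrightarrow> card (g x) \<le> a + b + 1"
  using card_tree[OF g_tree] by force

lemma rank_Elem: "x \<in> A \<Longrightarrow> rank (Elem x) + card (g x) = a + b + 2"
  using card_g_le by force

lemma card_mono_g: "x \<in> A \<Longrightarrow> g y \<subseteq> g x \<Longrightarrow> card (g y) \<le> card (g x)"
  using finite_tree[OF g_tree] by (simp add: card_mono)

lemma rank_mono:
  assumes "X \<in> carrier H" "Y \<in> carrier H" "Y \<noteq> One_hat" "X \<sqsubseteq>\<^bsub>H\<^esub> Y"
  shows "rank X \<le> rank Y"
  using assms card_mono_g by (auto simp: carrier_H intro!: diff_le_mono2)

text \<open>A tree that covers \<open>Zero_hat\<close> lies in no larger tree and so has
  \<open>a + b + 1\<close> points. If a tree covers a tree, they differ in one point, because any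
  single point of the difference could be removed first.\<close>

lemma rank_cover:
  assumes XY: "X \<in> carrier H" "Y \<in> carrier H" "Y \<noteq> One_hat" "X \<sqsubseteq>\<^bsub>H\<^esub> Y" "X \<noteq> Y"
    and cover: "\<And>Z. Z \<in> carrier H \<Longrightarrow> X \<sqsubseteq>\<^bsub>H\<^esub> Z \<Longrightarrow> Z \<sqsubseteq>\<^bsub>H\<^esub> Y \<Longrightarrow> Z = X \<or> Z = Y"
  shows "rank Y = rank X + 1"
proof -
  obtain y where y: "Y = Elem y" "y \<in> A" using XY by (auto simp: carrier_H)
  consider "X = Zero_hat" | x where "X = Elem x" "x \<in> A" using XY by (auto simp: carrier_H)
  then show ?thesis
  proof cases
    case 1
    have "\<not> card (g y) < a + b + 1"
    proof
      assume "card (g y) < a + b + 1"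
      then obtain U where U: "U \<in> trees" "g y \<subset> U" using ex_maximal_tree g_tree y by metis
      then obtain z where "z \<in> A" "g z = U" using g_surj by auto
      then show False using cover[of "Elem z"] 1 y U by (auto simp: carrier_H)
    qed
    then have "card (g y) = a + b + 1" using card_g_le y by force
    then show ?thesis using 1 y by simp
  next
    case 2
    have sub: "g y \<subseteq> g x" using XY 2 y by simp
    moreover have "g y \<noteq> g x" using XY 2 y g_inj by auto
    ultimately obtain q where q: "q \<in> g x" "q \<notin> g y" by auto
    then obtain z where z: "z \<in> A" "g z = g x - {q}" "g y \<subseteq> g z"
      using remove_ex 2 y sub by metis
    then have "Elem z = X \<or> Elem z = Y" using cover[of "Elem z"] 2 y by (auto simp: carrier_H)
    then have "z = y" using 2 y z q by auto
    then have "card (g x) = card (g y) + 1"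
      using z q finite_tree[OF g_tree[OF 2(2)]] card.remove[of "g x" q] by simp
    then show ?thesis using rank_Elem[of x] rank_Elem[of y] 2 y by simp
  qed
qed

section \<open>Signed sums over intervals\<close>

lemma finite_H: "finite (carrier H)"
  using bij_betw_finite[OF bij] finite_trees by (simp add: carrier_H)

lemma sign_rank: "x \<in> A \<Longrightarrow> (-1::int) ^ rank (Elem x) = (-1) ^ (a + b) * (-1) ^ card (g x)"
proof -
  assume "x \<in> A"
  then have "even (rank (Elem x) + card (g x) + (a + b))" using rank_Elem by simp
  then show ?thesis by (auto simp: minus_one_power_iff simp del: rank.simps)
qed

text \<open>From \<open>Zero_hat\<close>, the bottom contributes 1 and the trees contribute
  \<open>(-1) ^ (a + b) * (-1) ^ (a + b + 1) = -1\<close>. Between two trees, toggling one fixed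
  point of the difference pairs off the Boolean interval.\<close>

lemma sum_rank_interval:
  assumes UV: "U \<in> carrier H" "V \<in> carrier H" "V \<noteq> One_hat" "U \<sqsubseteq>\<^bsub>H\<^esub> V" "U \<noteq> V"
  shows "(\<Sum>Z\<in>\<lbrace>U..V\<rbrace>\<^bsub>H\<^esub>. (-1::int) ^ rank Z) = 0"
proof -
  obtain v where v: "V = Elem v" "v \<in> A" using UV by (auto simp: carrier_H)
  have sum_trees: "(\<Sum>Z\<in>Elem ` {z\<in>A. Q (g z)}. (-1::int) ^ rank Z) =
      (-1) ^ (a + b) * (\<Sum>S | S \<in> trees \<and> Q S. (-1) ^ card S)" for Q
  proof -
    have "(\<Sum>Z\<in>Elem ` {z\<in>A. Q (g z)}. (-1::int) ^ rank Z) = (\<Sum>z | z \<in> A \<and> Q (g z). (-1) ^ (a + b) * (-1) ^ card (g z))"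
      by (subst sum.reindex) (auto simp: inj_on_def sign_rank simp del: rank.simps intro!: sum.cong)
    also have "\<dots> = (\<Sum>S | S \<in> trees \<and> Q S. (-1) ^ (a + b) * (-1) ^ card S)"
      using bij g_surj by (intro sum.reindex_bij_betw[of g]) (auto simp: bij_betw_def inj_on_def image_iff g_tree)
    finally show ?thesis by (simp add: sum_distrib_left)
  qed
  consider "U = Zero_hat" | u where "U = Elem u" "u \<in> A" using UV by (auto simp: carrier_H)
  then show ?thesis
  proof cases
    case 1
    have "\<lbrace>U..V\<rbrace>\<^bsub>H\<^esub> = insert Zero_hat (Elem ` {z\<in>A. g v \<subseteq> g z})"
      using 1 v by (auto simp: at_least_at_most_def carrier_H)
    moreover have "finite (Elem ` {z\<in>A. g v \<subseteq> g z})"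
      using finite_H by (rule rev_finite_subset) (auto simp: carrier_H)
    ultimately have "(\<Sum>Z\<in>\<lbrace>U..V\<rbrace>\<^bsub>H\<^esub>. (-1::int) ^ rank Z) =
        1 + (\<Sum>Z\<in>Elem ` {z\<in>A. g v \<subseteq> g z}. (-1) ^ rank Z)"
      by (simp add: image_iff)
    then show ?thesis
      using sum_sign_above_tree[OF g_tree[OF v(2)]]
      by (simp add: sum_trees flip: power_add mult_2)
  next
    case 2
    have sub: "g v \<subseteq> g u" using UV 2 v by simp
    moreover have "g u \<noteq> g v" using UV 2 v g_inj by auto
    ultimately obtain q where q: "q \<in> g u" "q \<notin> g v" by auto
    have "\<lbrace>U..V\<rbrace>\<^bsub>H\<^esub> = Elem ` {z\<in>A. g v \<subseteq> g z \<and> g z \<subseteq> g u}"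
      using 2 v by (auto simp: at_least_at_most_def carrier_H)
    moreover have "(\<Sum>S | S \<in> trees \<and> g v \<subseteq> S \<and> S \<subseteq> g u. (-1::int) ^ card S) = 0"
    proof (rule sum_sign_reversing_involution[where \<phi> = "toggle q"])
      fix S assume "S \<in> {S. S \<in> trees \<and> g v \<subseteq> S \<and> S \<subseteq> g u}"
      then have S: "S \<in> trees" "g v \<subseteq> S" "S \<subseteq> g u" by auto
      have "g v \<subseteq> toggle q S" "toggle q S \<subseteq> g u" using S q by (auto simp: toggle_def)
      then show "toggle q S \<in> {S. S \<in> trees \<and> g v \<subseteq> S \<and> S \<subseteq> g u}"
        using tree_between[OF g_tree[OF 2(2)] g_tree[OF v(2)]] by simp
      show "(-1::int) ^ card (toggle q S) = - ((-1) ^ card S)"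
        using S finite_tree by (simp add: sign_toggle)
    qed simp
    ultimately show ?thesis using sum_trees[of "\<lambda>S. g v \<subseteq> S \<and> S \<subseteq> g u"] by simp
  qed
qed

lemma eulerian_interval:
  assumes XY: "X \<in> carrier H" "Y \<in> carrier H" "Y \<noteq> One_hat" "X \<sqsubseteq>\<^bsub>H\<^esub> Y"
  shows "eulerian_lattice (H\<lparr>carrier := \<lbrace>X..Y\<rbrace>\<^bsub>H\<^esub>\<rparr>)" (is "eulerian_lattice ?I")
proof -
  interpret partial_order H by (rule partial_order_H)
  have I: "Z \<in> \<lbrace>X..Y\<rbrace>\<^bsub>H\<^esub> \<longleftrightarrow> Z \<in> carrier H \<and> X \<sqsubseteq>\<^bsub>H\<^esub> Z \<and> Z \<sqsubseteq>\<^bsub>H\<^esub> Y" for Z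
    by (simp add: at_least_at_most_def)
  then have not_One: "Z \<noteq> One_hat" if "Z \<in> carrier ?I" for Z using that XY by auto
  have less: "U \<sqsubset>\<^bsub>?I\<^esub> V \<longleftrightarrow> U \<sqsubseteq>\<^bsub>H\<^esub> V \<and> U \<noteq> V" for U V by (simp add: lless_def)
  have rank_X: "rank X \<le> rank Z" if "Z \<in> carrier ?I" for Z
    using that not_One[OF that] XY by (auto simp: I intro: rank_mono)
  \<comment> \<open>A rank function of the interval must vanish at its bottom \<open>X\<close>. The
    subtraction is exact by \<open>rank_X\<close>, and the dummy rank of \<open>One_hat\<close> does
    not interfere by \<open>not_One\<close>.\<close>
  define \<rho> where "\<rho> Z = rank Z - rank X" for Z
  have "rank_function ?I \<rho>"
    unfolding rank_function_def
  proof (intro conjI allI impI)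
    fix Z assume "least ?I Z (carrier ?I)"
    then have "Z \<sqsubseteq>\<^bsub>H\<^esub> X" "X \<sqsubseteq>\<^bsub>H\<^esub> Z" "Z \<in> carrier H" using XY by (auto simp: least_def I)
    then have "Z = X" using XY by auto
    then show "\<rho> Z = 0" by (simp add: \<rho>_def)
  next
    fix U V assume c: "covered_by ?I U V"
    then have U: "U \<in> carrier ?I" and V: "V \<in> carrier ?I" and UV: "U \<sqsubseteq>\<^bsub>H\<^esub> V" "U \<noteq> V"
      by (auto simp: covered_by_def less)
    have "Z = U \<or> Z = V" if "Z \<in> carrier H" "U \<sqsubseteq>\<^bsub>H\<^esub> Z" "Z \<sqsubseteq>\<^bsub>H\<^esub> V" for Z
    proof -
      have "Z \<in> carrier ?I" using that U V XY by (auto simp: I intro: le_trans)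
      then show ?thesis using c that by (auto simp: covered_by_def less)
    qed
    then have "rank V = rank U + 1" using U V UV not_One[OF V] by (intro rank_cover) (auto simp: I)
    then show "\<rho> V = \<rho> U + 1" using rank_X[OF U] by (simp add: \<rho>_def)
  qed
  moreover have "card {Z \<in> \<lbrace>U..V\<rbrace>\<^bsub>?I\<^esub>. even (\<rho> Z)} = card {Z \<in> \<lbrace>U..V\<rbrace>\<^bsub>?I\<^esub>. odd (\<rho> Z)}"
    if U: "U \<in> carrier ?I" and V: "V \<in> carrier ?I" and UV: "U \<sqsubset>\<^bsub>?I\<^esub> V" for U V
  proof -
    have int: "\<lbrace>U..V\<rbrace>\<^bsub>?I\<^esub> = \<lbrace>U..V\<rbrace>\<^bsub>H\<^esub>"
      using U V XY by (auto simp: at_least_at_most_def intro: le_trans)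
    have "(-1::int) ^ \<rho> Z = (-1) ^ rank X * (-1) ^ rank Z" if "Z \<in> \<lbrace>U..V\<rbrace>\<^bsub>?I\<^esub>" for Z
    proof -
      have "Z \<in> carrier ?I" using that by (auto simp: at_least_at_most_def)
      then have "rank Z = rank X + \<rho> Z" using rank_X by (simp add: \<rho>_def)
      then show ?thesis by (simp add: power_add flip: power_mult_distrib mult.assoc)
    qed
    then have "(\<Sum>Z\<in>\<lbrace>U..V\<rbrace>\<^bsub>?I\<^esub>. (-1::int) ^ \<rho> Z) = (-1) ^ rank X * (\<Sum>Z\<in>\<lbrace>U..V\<rbrace>\<^bsub>H\<^esub>. (-1) ^ rank Z)"
      by (simp add: sum_distrib_left int)
    also have "\<dots> = 0"
      using sum_rank_interval[of U V] U V UV not_One[OF V] by (auto simp: I less)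
    finally show ?thesis
      using finite_H card_even_odd_iff_sum[of "\<lbrace>U..V\<rbrace>\<^bsub>?I\<^esub>" \<rho>] unfolding int
      by (metis (no_types, lifting) at_least_at_most_def finite_subset mem_Collect_eq subsetI)
  qed
  moreover have "lattice ?I" using lattice_interval[OF lattice_H] XY by blast
  moreover have "finite (carrier ?I)"
    using finite_H by (rule rev_finite_subset) (auto simp: at_least_at_most_def)
  ultimately show ?thesis unfolding eulerian_lattice_def by blast
qed

lemma eulerian_intervals_H: "eulerian_intervals (H\<lparr>carrier := carrier H - {One_hat}\<rparr>)"
  unfolding eulerian_intervals_def
proof (intro ballI impI)
  let ?P = "H\<lparr>carrier := carrier H - {One_hat}\<rparr>"
  fix X Y assume XY: "X \<in> carrier ?P" "Y \<in> carrier ?P" "X \<sqsubseteq>\<^bsub>?P\<^esub> Y"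
  have "\<lbrace>X..Y\<rbrace>\<^bsub>?P\<^esub> = \<lbrace>X..Y\<rbrace>\<^bsub>H\<^esub>"
    using XY by (auto simp: at_least_at_most_def)
  then show "eulerian_lattice (?P\<lparr>carrier := \<lbrace>X..Y\<rbrace>\<^bsub>?P\<^esub>\<rparr>)"
    using eulerian_interval[of X Y] XY by simp
qed

end

section \<open>The path of a tree\<close>

lemma sorted_wrt_set_unique:
  assumes "\<And>x y. R x y \<Longrightarrow> \<not> R y x"
  shows "sorted_wrt R xs \<Longrightarrow> sorted_wrt R ys \<Longrightarrow> set xs = set ys \<Longrightarrow> xs = ys"
proof (induction xs arbitrary: ys)
  case (Cons x xs)
  then obtain y ys' where ys: "ys = y # ys'" by (cases ys) auto
  have "x = y"
  proof (rule ccontr)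
    assume "x \<noteq> y"
    then have "x \<in> set ys'" "y \<in> set xs" using Cons.prems(3) ys by auto
    then show False using Cons.prems(1,2) assms[of x y] by (auto simp: ys)
  qed
  moreover have "x \<notin> set xs" "y \<notin> set ys'"
    using Cons.prems(1,2) assms[of x x] assms[of y y] by (auto simp: ys)
  ultimately have "set xs = set ys'" using Cons.prems(3) insert_ident[of x "set xs" "set ys'"] by (simp add: ys)
  then show ?case using Cons.IH[of ys'] Cons.prems(1,2) \<open>x = y\<close> by (simp add: ys)
qed simp

definition delete_nth :: "nat \<Rightarrow> 'a list \<Rightarrow> 'a list" where
  "delete_nth k xs = take k xs @ drop (Suc k) xs"

lemma delete_nth_map: "delete_nth k (map f xs) = map f (delete_nth k xs)"
  by (simp add: delete_nth_def take_map drop_map)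

text \<open>Ignoring position \<open>k\<close> reduces a comparison of the paths before and after a
  removal to the labels of the surviving points.\<close>

lemma delete_nth_cong:
  assumes "length xs = length ys" "\<And>j. j < length xs \<Longrightarrow> j \<noteq> k \<Longrightarrow> xs ! j = ys ! j"
  shows "delete_nth k xs = delete_nth k ys"
proof -
  have "take k xs = take k ys" "drop (Suc k) xs = drop (Suc k) ys"
    using assms by (auto intro: nth_equalityI)
  then show ?thesis by (simp add: delete_nth_def)
qed

lemma split_at_two:
  assumes "i < k" "k < length w"
  shows "w = take i w @ w ! i # drop (Suc i) (take k w) @ w ! k # drop (Suc k) w"
proof -
  have "take k w = take i w @ w ! i # drop (Suc i) (take k w)"
    using assms id_take_nth_drop[of i "take k w"] by (simp add: min_def)
  then show ?thesis using id_take_nth_drop[OF assms(2)] by (metis append_Cons append_assoc)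
qed

lemma split_at_adjacent:
  assumes "0 < k" "k < length w"
  shows "w = take (k - 1) w @ [w ! (k - 1), w ! k] @ drop (Suc k) w"
  using split_at_two[of "k - 1" k w] assms by simp

definition before :: "nat \<times> nat \<Rightarrow> nat \<times> nat \<Rightarrow> bool" where
  "before p q \<longleftrightarrow> snd p < snd q \<or> snd p = snd q \<and> fst q < fst p"

lemma before_trans: "before p q \<Longrightarrow> before q r \<Longrightarrow> before p r"
  by (auto simp: before_def)

lemma before_asym: "before p q \<Longrightarrow> \<not> before q p"
  by (auto simp: before_def)

lemma before_total: "p \<noteq> q \<Longrightarrow> before p q \<or> before q p"
  by (auto simp: before_def prod_eq_iff)

lemma ex_points:
  "finite T \<Longrightarrow> \<exists>L. sorted_wrt before L \<and> set L = T"
proof (induction rule: finite_induct)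
  case (insert p T)
  then obtain L where L: "sorted_wrt before L" "set L = T" by blast
  let ?L = "filter (\<lambda>q. before q p) L @ p # filter (before p) L"
  have "sorted_wrt before ?L"
    using L(1) by (auto simp: sorted_wrt_append sorted_wrt_filter intro: before_trans)
  have "set ?L = {q \<in> T. before q p} \<union> insert p {q \<in> T. before p q}" using L(2) by simp
  moreover have "before q p \<or> before p q" if "q \<in> T" for q
    using before_total[of p q] insert.hyps(2) that by auto
  ultimately have "set ?L = insert p T" by auto
  with \<open>sorted_wrt before ?L\<close> show ?case by blast
qed simp

definition points :: "(nat \<times> nat) set \<Rightarrow> (nat \<times> nat) list" where
  "points T = (SOME L. sorted_wrt before L \<and> set L = T)"

lemma points:
  assumes "finite T"
  shows "sorted_wrt before (points T)" "set (points T) = T"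
  using someI_ex[OF ex_points[OF assms]] by (simp_all add: points_def)

lemma points_unique:
  assumes "sorted_wrt before L" "set L = T"
  shows "points T = L"
proof -
  have "finite T" using assms(2) by auto
  then show ?thesis
    using sorted_wrt_set_unique[of before "points T" L] before_asym points assms by auto
qed

lemma distinct_points: "finite T \<Longrightarrow> distinct (points T)"
proof -
  assume "finite T"
  then have "before (points T ! i) (points T ! j)" if "i < j" "j < length (points T)" for i j
    using that points(1) sorted_wrt_nth_less by blast
  then show ?thesis
    by (metis before_asym distinct_conv_nth linorder_neqE_nat)
qed

lemma points_remove:
  assumes T: "finite T" and k: "k < length (points T)"
  shows "points (T - {points T ! k}) = delete_nth k (points T)"
proof (rule points_unique)
  let ?L = "points T"
  have L: "?L = take k ?L @ ?L ! k # drop (Suc k) ?L" using id_take_nth_drop[OF k] .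
  have "sorted_wrt before (take k ?L @ ?L ! k # drop (Suc k) ?L)" using points(1)[OF T] L by simp
  then show "sorted_wrt before (delete_nth k ?L)"
    by (auto simp: delete_nth_def sorted_wrt_append)
  have "distinct (take k ?L @ ?L ! k # drop (Suc k) ?L)" using distinct_points[OF T] L by simp
  moreover have "set (take k ?L @ ?L ! k # drop (Suc k) ?L) = T" using points(2)[OF T] L by simp
  ultimately show "set (delete_nth k ?L) = T - {?L ! k}"
    unfolding delete_nth_def by auto
qed

text \<open>Listing the points row by row from the bottom, and each row from right to left, the points of a
  tree correspond to the vertices of its path: a point that is not leftmost is followed by an
  east step, since its left neighbour comes next.\<close>

definition step_at :: "(nat \<times> nat) set \<Rightarrow> nat \<times> nat \<Rightarrow> step" where
  "step_at T p = (if \<not> leftmost T p then East else if topmost T p then Diag else North)"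

definition tree_path :: "(nat \<times> nat) set \<Rightarrow> step list" where
  "tree_path T = map (step_at T) (butlast (points T))"

text \<open>A column is closed once its topmost point is among the first \<open>i\<close> points.
  Exactly the north steps come from points that are not topmost, so the number of closed columns is
  the horizontal coordinate of the path.\<close>

definition closed_cols :: "(nat \<times> nat) set \<Rightarrow> nat \<Rightarrow> nat set" where
  "closed_cols T i = {fst (points T ! j) | j. j < i \<and> topmost T (points T ! j)}"

lemma closed_cols_Suc:
  "closed_cols T (Suc i) =
     (if topmost T (points T ! i) then insert (fst (points T ! i)) (closed_cols T i) else closed_cols T i)"
  by (auto simp: closed_cols_def less_Suc_eq)

lemma closed_cols_0 [simp]: "closed_cols T 0 = {}"
  by (simp add: closed_cols_def)

lemma closed_cols_mono: "i \<le> j \<Longrightarrow> closed_cols T i \<subseteq> closed_cols T j"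
  by (force simp: closed_cols_def)

lemma finite_closed_cols: "finite (closed_cols T i)"
  by (induction i) (simp_all add: closed_cols_Suc)

context nu_path
begin

definition width :: "nat \<Rightarrow> nat" where
  "width y = Max {x. (x, y) \<in> region \<nu>}"

lemma region_iff:
  assumes "y \<le> a"
  shows "(x, y) \<in> region \<nu> \<longleftrightarrow> x \<le> width y"
proof -
  have fin: "finite {x. (x, y) \<in> region \<nu>}"
    by (rule finite_subset[of _ "{..b}"]) (auto dest: region_bounds)
  then have "(width y, y) \<in> region \<nu>"
    using Max_in[OF fin] region_col0[OF assms] by (auto simp: width_def)
  then show ?thesis
    using region_left[of "width y" y x] Max_ge[OF fin, of x] by (auto simp: width_def)
qed

lemma width_le: "y \<le> a \<Longrightarrow> width y \<le> b"
  using region_iff[of y "width y"] region_bounds by auto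

lemma width_top: "width a = b"
  using width_le[of a] region_iff[of a b] region_top[of b] by simp

lemma horiz_eq:
  assumes "y \<le> a" "x \<le> width y"
  shows "horiz \<nu> (x, y) = width y - x"
proof -
  have "{k. \<forall>j\<le>k. (x + j, y) \<in> region \<nu>} = {..width y - x}"
    using assms by (auto simp: region_iff)
  moreover have "Max {..width y - x} = width y - x" by (intro Max_eqI) auto
  ultimately show ?thesis by (simp add: horiz_def)
qed

end

locale nu_tree = nu_path +
  fixes T assumes T: "T \<in> trees"
begin

abbreviation "L \<equiv> points T"
text \<open>The root is listed last and gives no step, so \<open>n\<close> is both the index of the
  root and the length of the path.\<close>

definition "n = length L - 1"

lemmas fin_T = finite_tree[OF T]
lemmas sorted_L = points(1)[OF fin_T]
lemmas set_L [simp] = points(2)[OF fin_T]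

lemma root_T: "(0, a) \<in> T" using T by (simp add: trees_iff)

lemma length_L [simp]: "length L = Suc n"
  using root_T set_L by (cases L) (auto simp: n_def)

lemma nth_L [simp]: "i \<le> n \<Longrightarrow> L ! i \<in> T"
  using nth_mem[of i L] length_L by simp

lemma ex_nth: "p \<in> T \<Longrightarrow> \<exists>i\<le>n. L ! i = p"
  using in_set_conv_nth[of p L] by (auto simp: less_Suc_eq_le)

lemma before_nth: "i \<le> n \<Longrightarrow> j \<le> n \<Longrightarrow> before (L ! i) (L ! j) \<longleftrightarrow> i < j"
  using sorted_wrt_nth_less[OF sorted_L] length_L before_asym
  by (metis le_imp_less_Suc linorder_neqE_nat)

lemma nth_eq: "i \<le> n \<Longrightarrow> j \<le> n \<Longrightarrow> L ! i = L ! j \<longleftrightarrow> i = j"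
  using distinct_points[OF fin_T] by (simp add: nth_eq_iff_index_eq)

lemma nth_root: "L ! n = (0, a)"
proof -
  obtain i where i: "i \<le> n" "L ! i = (0, a)" using ex_nth[OF root_T] by auto
  have "snd (L ! n) \<le> a" using tree_bounds[OF T, of "fst (L ! n)" "snd (L ! n)"] by simp
  then have "\<not> before (L ! i) (L ! n)" by (auto simp: i before_def)
  then show ?thesis using before_nth[of i n] i by simp
qed

lemma snd_mono: "i \<le> j \<Longrightarrow> j \<le> n \<Longrightarrow> snd (L ! i) \<le> snd (L ! j)"
  using before_nth[of i j] by (cases "i = j") (auto simp: before_def)

lemma snd_le: "i \<le> n \<Longrightarrow> snd (L ! i) \<le> a"
  using tree_bounds[OF T, of "fst (L ! i)" "snd (L ! i)"] by simp

lemma nth_region: "i \<le> n \<Longrightarrow> L ! i \<in> region \<nu>"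
  using nth_L trees_subset[OF T] by blast

lemma step_at_iff:
  assumes "p \<in> T"
  shows "step_at T p = East \<longleftrightarrow> \<not> leftmost T p" "step_at T p = North \<longleftrightarrow> \<not> topmost T p"
    "step_at T p = Diag \<longleftrightarrow> leftmost T p \<and> topmost T p"
  using tree_extremal[OF T assms] by (auto simp: step_at_def)

lemma snd_0: "snd (L ! 0) = 0"
proof -
  obtain x where "(x, 0) \<in> T" using T by (auto simp: trees_iff)
  then obtain i where "i \<le> n" "L ! i = (x, 0)" using ex_nth by blast
  then show ?thesis using snd_mono[of 0 i] by simp
qed

text \<open>A point to the left in the same row is listed later, so the row continues until its
  leftmost point. After that, the next row is not skipped because it contains a point of the
  tree.\<close>

lemma snd_Suc:
  assumes i: "i < n"
  shows "snd (L ! Suc i) = snd (L ! i) + (if step_at T (L ! i) = East then 0 else 1)"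
proof (cases "leftmost T (L ! i)")
  case False
  then obtain p where "p \<in> T" "left_in_row p (L ! i)" using i by (auto simp: leftmost_def)
  then obtain j where j: "j \<le> n" "left_in_row (L ! j) (L ! i)" using ex_nth by metis
  then have "i < j" using before_nth[of i j] i by (auto simp: before_def left_in_row_def)
  then have "snd (L ! Suc i) \<le> snd (L ! i)" using snd_mono[of "Suc i" j] j by (simp add: left_in_row_def)
  then show ?thesis using snd_mono[of i "Suc i"] i False step_at_iff[of "L ! i"] by simp
next
  case True
  have less: "snd (L ! i) < snd (L ! Suc i)"
  proof (rule ccontr)
    assume "\<not> ?thesis"
    then have "left_in_row (L ! Suc i) (L ! i)"
      using before_nth[of i "Suc i"] i by (auto simp: before_def left_in_row_def)
    then show False using True i nth_L[of "Suc i"] by (auto simp: leftmost_def)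
  qed
  then have "Suc (snd (L ! i)) \<le> a" using snd_le[of "Suc i"] i by simp
  then obtain x where "(x, Suc (snd (L ! i))) \<in> T" using T by (auto simp: trees_iff)
  then obtain j where j: "j \<le> n" "L ! j = (x, Suc (snd (L ! i)))" using ex_nth by blast
  then have "i < j" using before_nth[of i j] i by (simp add: before_def)
  then have "snd (L ! Suc i) \<le> Suc (snd (L ! i))" using snd_mono[of "Suc i" j] j by simp
  then show ?thesis using less True step_at_iff[of "L ! i"] i by simp
qed

text \<open>Each column is listed from bottom to top, so its topmost point is its last one.\<close>

lemma fst_notin_closed:
  assumes "i \<le> n" shows "fst (L ! i) \<notin> closed_cols T i"
proof
  assume "fst (L ! i) \<in> closed_cols T i"
  then obtain j where j: "j < i" "topmost T (L ! j)" "fst (L ! i) = fst (L ! j)"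
    by (auto simp: closed_cols_def)
  then have "snd (L ! i) \<le> snd (L ! j)"
    using topmostD[of T "fst (L ! j)" "snd (L ! j)" "snd (L ! i)"] nth_L[OF assms] by (metis prod.collapse)
  then show False using before_nth[of j i] assms j by (auto simp: before_def)
qed

text \<open>Otherwise the topmost point of column \<open>x\<close> is still to come. It would be
  strictly northeast of the current point, and the corner \<open>(x, snd (L ! i))\<close> in the
  region would make the two incompatible.\<close>

lemma col_closed:
  assumes i: "i \<le> n" and x: "fst (L ! i) < x" "(x, snd (L ! i)) \<in> region \<nu>"
  shows "x \<in> closed_cols T i"
proof -
  obtain y where "(x, y) \<in> T" using T region_bounds[OF x(2)] by (auto simp: trees_iff)
  then obtain t where t: "topmost T (x, t)" using ex_topmost[OF fin_T] by blast
  then obtain j where j: "j \<le> n" "L ! j = (x, t)" using ex_nth[of "(x, t)"] by (auto simp: topmost_def)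
  have "\<not> i \<le> j"
  proof
    assume "i \<le> j"
    then have "i < j" using j x by (cases "i = j") auto
    then have "snd (L ! i) < t" using before_nth[of i j] i j x by (auto simp: before_def)
    then show False
      using compatibleD[OF T, of "fst (L ! i)" "snd (L ! i)" x t] x i t by (auto simp: topmost_def)
  qed
  then show ?thesis using t j unfolding closed_cols_def by (intro CollectI exI[of _ j]) auto
qed

lemma closed_region:
  assumes i: "i \<le> n" and x: "x \<in> closed_cols T i"
  shows "(x, snd (L ! i)) \<in> region \<nu>"
proof -
  obtain j where "j < i" "x = fst (L ! j)" using x by (auto simp: closed_cols_def)
  then show ?thesis
    using region_up[of x "snd (L ! j)" "snd (L ! i)"] nth_region[of j] snd_mono[of j i] snd_le[OF i] i
    by simp
qed

text \<open>By \<open>tree_extremal\<close>, east and diagonal steps come exactly from topmost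
  points, and each of them closes a new column.\<close>

lemma end_point_take:
  "i \<le> n \<Longrightarrow> end_point (take i (tree_path T)) = (card (closed_cols T i), snd (L ! i))"
proof (induction i)
  case (Suc i)
  have "take (Suc i) (tree_path T) = take i (tree_path T) @ [step_at T (L ! i)]"
    using Suc.prems by (simp add: tree_path_def take_Suc_conv_app_nth nth_butlast)
  moreover have "card (closed_cols T (Suc i)) =
      card (closed_cols T i) + (if step_at T (L ! i) = North then 0 else 1)"
    using fst_notin_closed[of i] Suc.prems step_at_iff[of "L ! i"] finite_closed_cols
    by (simp add: closed_cols_Suc)
  ultimately show ?case using Suc snd_Suc[of i] by (simp add: end_point_snoc)
qed (simp add: snd_0)

text \<open>The value of \<open>horiz\<close> at the \<open>i\<close>-th vertex is the number of columns to the left of the \<open>i\<close>-th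
  point that are still open. Hence it returns to the same value exactly when the column of that
  point is visited again.\<close>

definition h :: "nat \<Rightarrow> nat" where
  "h i = card {z. z < fst (L ! i) \<and> z \<notin> closed_cols T i}"

text \<open>The \<open>width + 1\<close> columns that meet the region in this row are the column of
  the point itself, the open columns to its left and the closed columns; by
  \<open>col_closed\<close> no open column is left on the right. The point's own column absorbs the
  off-by-one.\<close>

lemma h_plus_card:
  assumes i: "i \<le> n"
  shows "h i + card (closed_cols T i) = width (snd (L ! i))"
proof -
  let ?x = "fst (L ! i)" and ?w = "width (snd (L ! i))" and ?C = "closed_cols T i"
  have reg: "(x, snd (L ! i)) \<in> region \<nu> \<longleftrightarrow> x \<le> ?w" for x using region_iff snd_le[OF i] by simp
  have "{..?w} = insert ?x ({z. z < ?x \<and> z \<notin> ?C} \<union> ?C)"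
    using col_closed[OF i] closed_region[OF i] reg nth_region[OF i] reg[of ?x]
    by (auto simp: not_less) (metis linorder_neqE_nat not_less)
  then have "card {..?w} = card (insert ?x ({z. z < ?x \<and> z \<notin> ?C} \<union> ?C))" by simp
  also have "\<dots> = Suc (card ({z. z < ?x \<and> z \<notin> ?C} \<union> ?C))"
    using fst_notin_closed[OF i] finite_closed_cols by simp
  also have "card ({z. z < ?x \<and> z \<notin> ?C} \<union> ?C) = h i + card ?C"
    unfolding h_def using finite_closed_cols by (intro card_Un_disjoint) auto
  finally show ?thesis by simp
qed

lemma horiz_take: "i \<le> n \<Longrightarrow> horiz \<nu> (end_point (take i (tree_path T))) = h i"
  using horiz_eq[OF snd_le] h_plus_card by (metis add_diff_cancel_right' end_point_take le_add2)

lemma length_tree_path [simp]: "length (tree_path T) = n"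
  by (simp add: tree_path_def)

lemma tree_path_nth: "i < n \<Longrightarrow> tree_path T ! i = step_at T (L ! i)"
  by (simp add: tree_path_def nth_butlast)

text \<open>By \<open>h_plus_card\<close> a vertex has exactly \<open>h i\<close> units of room to
  its right. A diagonal step needs one unit: its point is topmost and not the root, so it is not in
  column 0, and column 0 is still open to its left.\<close>

lemma tree_path_in_paths: "tree_path T \<in> schroeder_paths \<nu>"
  unfolding schroeder_paths_def
proof (intro CollectI conjI allI impI)
  have "h n = 0" unfolding h_def nth_root by simp
  then have "card (closed_cols T n) = b" using h_plus_card[of n] by (simp add: nth_root width_top)
  then show "end_point (tree_path T) = end_point \<nu>"
    using end_point_take[of n] by (simp add: nth_root)
  have reg: "(x, snd (L ! i)) \<in> region \<nu>" if "i \<le> n" "x \<le> h i + card (closed_cols T i)" for x i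
    using that h_plus_card[of i] region_iff[OF snd_le[of i]] by simp
  show "vertices (tree_path T) \<subseteq> region \<nu>"
  proof
    fix p assume "p \<in> vertices (tree_path T)"
    then obtain u v where uv: "p = end_point u" "tree_path T = u @ v" by (auto simp: vertices_def)
    then have "length u \<le> n" "u = take (length u) (tree_path T)"
      using length_tree_path by (metis length_append le_add1, simp)
    then show "p \<in> region \<nu>" using end_point_take[of "length u"] reg[of "length u"] uv(1) by simp
  qed
  fix u v assume uv: "tree_path T = u @ Diag # v"
  let ?i = "length u"
  have i: "?i < n" using arg_cong[OF uv, of length] by simp
  have "step_at T (L ! ?i) = Diag" using tree_path_nth[OF i] uv by (simp add: nth_append)
  then have lt: "leftmost T (L ! ?i)" "topmost T (L ! ?i)" using step_at_iff[of "L ! ?i"] i by auto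
  have not_root: "L ! ?i \<noteq> (0, a)" using nth_eq[of ?i n] i nth_root by simp
  have "fst (L ! ?i) \<noteq> 0"
  proof
    assume "fst (L ! ?i) = 0"
    then have "a \<le> snd (L ! ?i)"
      using topmostD[of T 0 "snd (L ! ?i)" a] lt root_T by (metis prod.collapse)
    then show False using not_root snd_le[of ?i] i \<open>fst (L ! ?i) = 0\<close> by (metis prod.collapse less_imp_le le_antisym)
  qed
  moreover have "0 \<notin> closed_cols T ?i"
    using fst_notin_closed[of n] closed_cols_mono[of ?i n T] i by (auto simp: nth_root)
  ultimately have "0 \<in> {z. z < fst (L ! ?i) \<and> z \<notin> closed_cols T ?i}" by simp
  moreover have "finite {z. z < fst (L ! ?i) \<and> z \<notin> closed_cols T ?i}" by simp
  ultimately have "h ?i \<noteq> 0" unfolding h_def by (metis card_0_eq empty_iff)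
  moreover have "u = take ?i (tree_path T)" using uv by simp
  ultimately show "end_point (u @ [East]) \<in> region \<nu>"
    using reg[of ?i] end_point_take[of ?i] i by (simp add: end_point_snoc)
qed

text \<open>Positions suffice to express vertical neighbours, since consecutive visits to a column
  in the list go upwards.\<close>

definition below :: "nat \<Rightarrow> nat \<Rightarrow> bool" where
  "below i k \<longleftrightarrow> i < k \<and> fst (L ! i) = fst (L ! k) \<and> (\<forall>j. i < j \<and> j < k \<longrightarrow> fst (L ! j) \<noteq> fst (L ! k))"

text \<open>Between the two visits to column \<open>?x\<close> only points to the right of it are
  listed, as a point to the left would be incompatible with \<open>L ! k\<close>. So the columns
  left of \<open>?x\<close> do not change, and \<open>h\<close> comes back to its value. Strictly in
  between, the open column \<open>?x\<close> itself is counted in addition.\<close>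

lemma h_below:
  assumes ik: "below i k" and k: "k \<le> n"
  shows "h i = h k" "\<And>j. i < j \<Longrightarrow> j < k \<Longrightarrow> h k < h j"
proof -
  let ?x = "fst (L ! k)"
  have i: "i < k" "fst (L ! i) = ?x" using ik by (auto simp: below_def)
  have right: "?x < fst (L ! j)" if "i < j" "j < k" for j
  proof (rule ccontr)
    assume "\<not> ?thesis"
    then have less: "fst (L ! j) < ?x" using ik that by (auto simp: below_def)
    then have "snd (L ! j) < snd (L ! k)" using before_nth[of j k] that k by (auto simp: before_def)
    then have "(?x, snd (L ! j)) \<notin> region \<nu>"
      using compatibleD[OF T, of "fst (L ! j)" "snd (L ! j)" ?x "snd (L ! k)"] less that k by simp
    moreover have "(?x, snd (L ! i)) \<in> region \<nu>" using nth_region[of i] i k by (metis less_imp_le order.trans prod.collapse)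
    ultimately show False
      using region_up[of ?x "snd (L ! i)" "snd (L ! j)"] snd_mono[of i j] snd_le[of j] that k by simp
  qed
  have same: "{z. z < ?x \<and> z \<notin> closed_cols T j} = {z. z < ?x \<and> z \<notin> closed_cols T i}"
    if "i \<le> j" "j \<le> k" for j
  proof -
    have "z \<in> closed_cols T i" if z: "z \<in> closed_cols T j" "z < ?x" for z
    proof -
      obtain m where m: "m < j" "topmost T (L ! m)" "z = fst (L ! m)" using z by (auto simp: closed_cols_def)
      have "\<not> i < m" using right[of m] m z \<open>j \<le> k\<close> by auto
      moreover have "m \<noteq> i" using m i z by auto
      ultimately show ?thesis using m unfolding closed_cols_def by (intro CollectI exI[of _ m]) auto
    qed
    then show ?thesis using closed_cols_mono[OF that(1)] by blast
  qed
  show "h i = h k" using same[of k] i by (simp add: h_def)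
  fix j assume j: "i < j" "j < k"
  have "?x \<notin> closed_cols T j"
    using fst_notin_closed[OF k] closed_cols_mono[of j k T] j by auto
  then have "insert ?x {z. z < ?x \<and> z \<notin> closed_cols T j} \<subseteq> {z. z < fst (L ! j) \<and> z \<notin> closed_cols T j}"
    using right[OF j] by auto
  then have "card (insert ?x {z. z < ?x \<and> z \<notin> closed_cols T j}) \<le> h j"
    unfolding h_def by (intro card_mono) auto
  then show "h k < h j" using same[of j] same[of k] j by (simp add: h_def)
qed

lemma ex_below:
  assumes k: "k \<le> n" and p: "p \<in> T" "above_in_column (L ! k) p"
  obtains i where "below i k"
proof -
  obtain j where j: "j \<le> n" "L ! j = p" using ex_nth[OF p(1)] by blast
  let ?I = "{i. i < k \<and> fst (L ! i) = fst (L ! k)}"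
  have "j < k" using before_nth[of j k] j k p by (auto simp: before_def above_in_column_def)
  then have "j \<in> ?I" using j p by (auto simp: above_in_column_def)
  then have "Max ?I \<in> ?I" by (intro Max_in) auto
  moreover have "i \<le> Max ?I" if "i \<in> ?I" for i using that by (intro Max_ge) auto
  ultimately have "below (Max ?I) k" unfolding below_def by fastforce
  then show thesis ..
qed

lemma ex_above:
  assumes i: "i \<le> n" and "\<not> topmost T (L ! i)"
  obtains k where "k \<le> n" "below i k"
proof -
  obtain p where p: "p \<in> T" "above_in_column p (L ! i)" using assms by (auto simp: topmost_def)
  obtain j where j: "j \<le> n" "L ! j = p" using ex_nth[OF p(1)] by blast
  let ?K = "{k. i < k \<and> k \<le> n \<and> fst (L ! k) = fst (L ! i)}"
  have "i < j" using before_nth[of i j] j i p by (auto simp: before_def above_in_column_def)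
  then have "j \<in> ?K" using j p by (auto simp: above_in_column_def)
  then have "Min ?K \<in> ?K" by (intro Min_in) auto
  moreover have "Min ?K \<le> k" if "k \<in> ?K" for k using that by (intro Min_le) auto
  ultimately have "below i (Min ?K)" unfolding below_def by fastforce
  then show thesis using that \<open>Min ?K \<in> ?K\<close> by blast
qed

lemma below_snd: "below i k \<Longrightarrow> k \<le> n \<Longrightarrow> above_in_column (L ! k) (L ! i)"
  using before_nth[of i k] by (auto simp: below_def before_def above_in_column_def)

lemma last_same_horiz_iff:
  assumes "i < k" "k \<le> n"
  shows "last_same_horiz \<nu> (take i (tree_path T)) (drop i (take k (tree_path T))) \<longleftrightarrow>
    h i = h k \<and> (\<forall>j. i < j \<and> j < k \<longrightarrow> h j \<noteq> h k)"
proof -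
  let ?w = "tree_path T"
  have cat': "take j ?w @ drop j (take k ?w) = take k ?w" if "j \<le> k" for j k
    using that by (metis append_take_drop_id min.absorb1 take_take)
  note cat = cat'[of i]
  have between: "(\<forall>m\<^sub>1 m\<^sub>2. drop i (take k ?w) = m\<^sub>1 @ m\<^sub>2 \<and> m\<^sub>1 \<noteq> [] \<and> m\<^sub>2 \<noteq> [] \<longrightarrow>
        horiz \<nu> (end_point (take i ?w @ m\<^sub>1)) \<noteq> h k) \<longleftrightarrow> (\<forall>j. i < j \<and> j < k \<longrightarrow> h j \<noteq> h k)"
  proof (intro iffI allI impI)
    fix j assume A: "\<forall>m\<^sub>1 m\<^sub>2. drop i (take k ?w) = m\<^sub>1 @ m\<^sub>2 \<and> m\<^sub>1 \<noteq> [] \<and> m\<^sub>2 \<noteq> [] \<longrightarrow>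
        horiz \<nu> (end_point (take i ?w @ m\<^sub>1)) \<noteq> h k" and j: "i < j \<and> j < k"
    have eqs: "take i ?w @ drop i (take j ?w) = take j ?w" "take j ?w @ drop j (take k ?w) = take k ?w"
      "take i ?w @ drop i (take k ?w) = take k ?w"
      using cat'[of i j] cat'[of j k] cat'[of i k] j by auto
    then have "take i ?w @ drop i (take k ?w) = take i ?w @ drop i (take j ?w) @ drop j (take k ?w)"
      by (simp only: append_assoc[symmetric])
    then have "drop i (take k ?w) = drop i (take j ?w) @ drop j (take k ?w)"
      by (simp only: same_append_eq)
    moreover have "drop i (take j ?w) \<noteq> []" "drop j (take k ?w) \<noteq> []" using j assms by auto
    ultimately have "horiz \<nu> (end_point (take i ?w @ drop i (take j ?w))) \<noteq> h k" using A by blast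
    then show "h j \<noteq> h k" unfolding eqs(1) using horiz_take[of j] j assms by simp
  next
    fix m1 m2 assume A: "\<forall>j. i < j \<and> j < k \<longrightarrow> h j \<noteq> h k"
      and m: "drop i (take k ?w) = m1 @ m2 \<and> m1 \<noteq> [] \<and> m2 \<noteq> []"
    let ?j = "i + length m1"
    have "length (m1 @ m2) = k - i" using m assms by (metis length_drop length_take length_tree_path min.absorb2)
    then have j: "i < ?j" "?j < k" using m by (auto simp flip: length_greater_0_conv)
    have "take i ?w @ m1 @ m2 = take k ?w" using cat[of k] m assms by simp
    then have "take ?j (take i ?w @ m1 @ m2) = take ?j ?w" using j by simp
    then have "take i ?w @ m1 = take ?j ?w" using assms by simp
    then show "horiz \<nu> (end_point (take i ?w @ m1)) \<noteq> h k"
      using A j horiz_take[of ?j] assms by simp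
  qed
  have "horiz \<nu> (end_point (take i ?w @ drop i (take k ?w))) = h k"
    "horiz \<nu> (end_point (take i ?w)) = h i"
    using cat[of k] assms horiz_take[of k] horiz_take[of i] by simp_all
  moreover have "drop i (take k ?w) \<noteq> []" using assms by simp
  ultimately show ?thesis
    unfolding last_same_horiz_def using between by metis
qed

lemma last_same_horiz_below:
  assumes "below i k" "k \<le> n"
  shows "last_same_horiz \<nu> (take i (tree_path T)) (drop i (take k (tree_path T)))"
proof -
  have "i < k" using assms by (simp add: below_def)
  then show ?thesis using last_same_horiz_iff h_below[OF assms] assms by force
qed

text \<open>A north step has a next point \<open>k'\<close> above it in its column. By
  \<open>h_below\<close> the first return of \<open>h\<close> to its value happens at
  \<open>k'\<close>, which forces \<open>k = k'\<close>.\<close>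

lemma below_last_same_horiz:
  assumes ik: "i < k" "k \<le> n" and N: "tree_path T ! i = North"
    and lsh: "last_same_horiz \<nu> (take i (tree_path T)) (drop i (take k (tree_path T)))"
  shows "below i k"
proof -
  have "\<not> topmost T (L ! i)" using N ik tree_path_nth[of i] step_at_iff[of "L ! i"] by simp
  then obtain k' where k': "k' \<le> n" "below i k'" using ex_above[of i] ik by auto
  have hk: "h i = h k" "\<And>j. i < j \<Longrightarrow> j < k \<Longrightarrow> h j \<noteq> h k" using lsh last_same_horiz_iff[OF ik] by auto
  have "k = k'"
    using h_below[OF k'(2,1)] hk k' ik by (cases k k' rule: linorder_cases) (force simp: below_def)+
  then show ?thesis using k' by simp
qed

end

section \<open>Contractions of paths\<close>

text \<open>In terms of positions: a contraction deletes an east step, or a diagonal step after an east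
  step, and turns one or two earlier steps into diagonal steps.\<close>

definition index_contraction :: "step list \<Rightarrow> step list \<Rightarrow> nat \<Rightarrow> step list \<Rightarrow> bool" where
  "index_contraction \<nu> w k w' \<longleftrightarrow> k < length w \<and>
     ((0 < k \<and> w ! (k - 1) = East \<and> w ! k = North \<and> w' = delete_nth k (w[k - 1 := Diag])) \<or>
      (\<exists>i<k. w ! i = North \<and> last_same_horiz \<nu> (take i w) (drop i (take k w)) \<and>
         (w ! k = East \<and> w' = delete_nth k (w[i := Diag]) \<or>
          w ! (k - 1) = East \<and> w ! k = Diag \<and> w' = delete_nth k (w[i := Diag, k - 1 := Diag]))))"

lemma path_contraction_iff: "path_contraction \<nu> w w' \<longleftrightarrow> (\<exists>k. index_contraction \<nu> w k w')"
proof
  assume "path_contraction \<nu> w w'"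
  then show "\<exists>k. index_contraction \<nu> w k w'"
  proof cases
    case (right u v)
    have "index_contraction \<nu> w (Suc (length u)) w'"
      by (simp add: right index_contraction_def delete_nth_def nth_append list_update_append)
    then show ?thesis ..
  next
    case (left u v z)
    let ?k = "Suc (length u + length v)"
    have "?k < length w" "length u < ?k" "w ! length u = North" "w ! ?k = East"
      "last_same_horiz \<nu> (take (length u) w) (drop (length u) (take ?k w))"
      "w' = delete_nth ?k (w[length u := Diag])"
      using left by (simp_all add: delete_nth_def nth_append list_update_append)
    then have "index_contraction \<nu> w ?k w'" unfolding index_contraction_def by blast
    then show ?thesis ..
  next
    case (diagonal u v z)
    \<comment> \<open>The rule deletes the east step. Deleting the diagonal step after it and
      overwriting the east step by \<open>Diag\<close> gives the same list, but the deleted position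
      is now that of the point removed from the tree.\<close>
    let ?k = "Suc (Suc (length u + length v))"
    have "?k < length w" "length u < ?k" "w ! length u = North" "w ! (?k - 1) = East" "w ! ?k = Diag"
      "last_same_horiz \<nu> (take (length u) w) (drop (length u) (take ?k w))"
      "w' = delete_nth ?k (w[length u := Diag, ?k - 1 := Diag])"
      using diagonal by (simp_all add: delete_nth_def nth_append list_update_append eval_nat_numeral)
    then have "index_contraction \<nu> w ?k w'" unfolding index_contraction_def by blast
    then show ?thesis ..
  qed
next
  assume "\<exists>k. index_contraction \<nu> w k w'"
  then obtain k where k: "k < length w" and
    "(0 < k \<and> w ! (k - 1) = East \<and> w ! k = North \<and> w' = delete_nth k (w[k - 1 := Diag])) \<or>
      (\<exists>i<k. w ! i = North \<and> last_same_horiz \<nu> (take i w) (drop i (take k w)) \<and>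
         (w ! k = East \<and> w' = delete_nth k (w[i := Diag]) \<or>
          w ! (k - 1) = East \<and> w ! k = Diag \<and> w' = delete_nth k (w[i := Diag, k - 1 := Diag])))"
    by (auto simp: index_contraction_def)
  then consider
      (right) "0 < k" "w ! (k - 1) = East" "w ! k = North" "w' = delete_nth k (w[k - 1 := Diag])"
    | (left) i where "i < k" "w ! i = North" "last_same_horiz \<nu> (take i w) (drop i (take k w))"
        "w ! k = East" "w' = delete_nth k (w[i := Diag])"
    | (diagonal) i where "i < k" "w ! i = North" "last_same_horiz \<nu> (take i w) (drop i (take k w))"
        "w ! (k - 1) = East" "w ! k = Diag" "w' = delete_nth k (w[i := Diag, k - 1 := Diag])"
    by auto
  then show "path_contraction \<nu> w w'"
  proof cases
    case right
    define u v where "u = take (k - 1) w" and "v = drop (Suc k) w"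
    have w: "w = u @ [East, North] @ v" "k = Suc (length u)"
      using split_at_adjacent[OF right(1) k] right k by (simp_all add: u_def v_def)
    then have "w' = u @ [Diag] @ v"
      by (simp add: right(4) delete_nth_def list_update_append)
    then show ?thesis using w(1) path_contraction.right by simp
  next
    case left
    define u v z where "u = take i w" and "v = drop (Suc i) (take k w)" and "z = drop (Suc k) w"
    have w: "w = u @ [North] @ v @ [East] @ z" "i = length u" "k = Suc (length u + length v)"
      using split_at_two[OF left(1) k] left k by (simp_all add: u_def v_def z_def)
    have "w' = u @ [Diag] @ v @ z" "drop i (take k w) = North # v" "take i w = u"
      using left(5) unfolding w(1) by (simp_all add: delete_nth_def list_update_append w(2,3))
    then show ?thesis using w(1) path_contraction.left[of \<nu> u v z] left(3) by simp
  next
    case diagonal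
    have "k - 1 < length w" using k by simp
    have "i \<noteq> k - 1" using diagonal(2,4) by auto
    then have "i < k - 1" using diagonal(1) by simp
    define u v z where "u = take i w" and "v = drop (Suc i) (take (k - 1) w)" and "z = drop (Suc k) w"
    have "w = u @ [North] @ v @ [East] @ drop (Suc (k - 1)) w"
      using split_at_two[OF \<open>i < k - 1\<close> \<open>k - 1 < length w\<close>] diagonal by (simp add: u_def v_def)
    moreover have "drop (Suc (k - 1)) w = Diag # z"
      using Cons_nth_drop_Suc[OF k] diagonal(1,5) by (simp add: z_def)
    ultimately have w: "w = u @ [North] @ v @ [East, Diag] @ z" by simp
    have ik: "i = length u" "k = Suc (Suc (length u + length v))"
      using \<open>i < k - 1\<close> \<open>k - 1 < length w\<close> by (simp_all add: u_def v_def)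
    have "w' = u @ [Diag] @ v @ [Diag] @ z" "drop i (take k w) = North # v @ [East]" "take i w = u"
      using diagonal(6) unfolding w by (simp_all add: delete_nth_def list_update_append ik eval_nat_numeral)
    then show ?thesis using w path_contraction.diagonal[of \<nu> u v z] diagonal(3) by simp
  qed
qed

context nu_tree
begin

section \<open>Removing a point and its effect on the path\<close>

lemma remove_tree:
  assumes q: "q \<in> T" "q \<noteq> (0, a)"
    and row: "\<exists>p\<in>T. p \<noteq> q \<and> snd p = snd q" and col: "\<exists>p\<in>T. p \<noteq> q \<and> fst p = fst q"
  shows "T - {q} \<in> trees"
proof -
  have "\<exists>x. (x, y) \<in> T - {q}" if "y \<le> a" for y
    using that row T unfolding trees_iff by (cases "y = snd q") (metis Diff_iff prod.collapse singletonD, metis Diff_iff singletonD snd_conv)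
  moreover have "\<exists>y. (x, y) \<in> T - {q}" if "x \<le> b" for x
    using that col T unfolding trees_iff by (cases "x = fst q") (metis Diff_iff prod.collapse singletonD, metis Diff_iff singletonD fst_conv)
  ultimately show ?thesis
    using T q(2) compatible_subset[of T "T - {q}"] by (auto simp: trees_iff)
qed

lemma remove_tree_neighbours:
  assumes "q \<in> T" "T - {q} \<in> trees"
  shows "\<exists>p\<in>T. p \<noteq> q \<and> snd p = snd q" "\<exists>p\<in>T. p \<noteq> q \<and> fst p = fst q" "q \<noteq> (0, a)"
proof -
  obtain x y where q: "q = (x, y)" by fastforce
  have "x \<le> b" "y \<le> a" using tree_bounds[OF T] assms(1) q by auto
  then obtain x' y' where "(x', y) \<in> T - {q}" "(x, y') \<in> T - {q}"
    using assms(2) unfolding trees_iff by meson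
  then show "\<exists>p\<in>T. p \<noteq> q \<and> snd p = snd q" "\<exists>p\<in>T. p \<noteq> q \<and> fst p = fst q"
    unfolding q by force+
  show "q \<noteq> (0, a)" using assms(2) by (auto simp: trees_iff)
qed

text \<open>Only the right neighbour of a removed leftmost point becomes leftmost, and it is listed
  immediately before that point.\<close>

lemma leftmost_remove:
  assumes j: "j \<le> n" "j \<noteq> k" and k: "k \<le> n"
  shows "leftmost (T - {L ! k}) (L ! j) \<longleftrightarrow>
    leftmost T (L ! j) \<or> leftmost T (L ! k) \<and> Suc j = k \<and> snd (L ! j) = snd (L ! k)"
proof -
  have ne: "L ! j \<noteq> L ! k" using nth_eq j k by simp
  show ?thesis
  proof (intro iffI)
    assume l: "leftmost (T - {L ! k}) (L ! j)"
    show "leftmost T (L ! j) \<or> leftmost T (L ! k) \<and> Suc j = k \<and> snd (L ! j) = snd (L ! k)"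
    proof (cases "leftmost T (L ! j)")
      case False
      then have left: "left_in_row (L ! k) (L ! j)" using l by (auto simp: leftmost_def)
      then have "leftmost T (L ! k)" using l nth_L[OF k] by (auto simp: leftmost_def left_in_row_def)
      have "j < k" using before_nth[of j k] left j k by (auto simp: before_def left_in_row_def)
      moreover have "\<not> Suc j < k"
      proof
        assume *: "Suc j < k"
        then have "snd (L ! Suc j) = snd (L ! j)"
          using snd_mono[of j "Suc j"] snd_mono[of "Suc j" k] k left by (simp add: left_in_row_def)
        then have "left_in_row (L ! Suc j) (L ! j)"
          using before_nth[of j "Suc j"] * k by (auto simp: before_def left_in_row_def)
        then show False using l nth_eq[of "Suc j" k] nth_L[of "Suc j"] * k by (auto simp: leftmost_def)
      qed
      ultimately show ?thesis using \<open>leftmost T (L ! k)\<close> left by (auto simp: left_in_row_def)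
    qed simp
  next
    assume "leftmost T (L ! j) \<or> leftmost T (L ! k) \<and> Suc j = k \<and> snd (L ! j) = snd (L ! k)"
    then show "leftmost (T - {L ! k}) (L ! j)"
    proof
      assume A: "leftmost T (L ! k) \<and> Suc j = k \<and> snd (L ! j) = snd (L ! k)"
      have "\<not> left_in_row p (L ! j)" if p: "p \<in> T" "p \<noteq> L ! k" for p
      proof
        assume left: "left_in_row p (L ! j)"
        obtain m where m: "m \<le> n" "L ! m = p" using ex_nth[OF p(1)] by blast
        have "j < m" using before_nth[of j m] m j left by (auto simp: before_def left_in_row_def)
        moreover have "m \<noteq> k" using m p by auto
        ultimately have "before (L ! k) p" using before_nth[of k m] A m k by auto
        then have "left_in_row p (L ! k)" using A left by (auto simp: before_def left_in_row_def)
        then show False using A p by (auto simp: leftmost_def)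
      qed
      then show ?thesis using ne j by (auto simp: leftmost_def)
    qed (use ne in \<open>auto simp: leftmost_def\<close>)
  qed
qed

text \<open>Only the next point below a removed topmost point becomes topmost. It may be far away in
  the list, hence \<open>below\<close> and the search by \<open>horiz\<close>.\<close>

lemma topmost_remove:
  assumes j: "j \<le> n" "j \<noteq> k" and k: "k \<le> n"
  shows "topmost (T - {L ! k}) (L ! j) \<longleftrightarrow> topmost T (L ! j) \<or> topmost T (L ! k) \<and> below j k"
proof -
  have ne: "L ! j \<noteq> L ! k" using nth_eq j k by simp
  show ?thesis
  proof (intro iffI)
    assume l: "topmost (T - {L ! k}) (L ! j)"
    show "topmost T (L ! j) \<or> topmost T (L ! k) \<and> below j k"
    proof (cases "topmost T (L ! j)")
      case False
      then have above: "above_in_column (L ! k) (L ! j)" using l by (auto simp: topmost_def)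
      then have "topmost T (L ! k)" using l nth_L[OF k] by (auto simp: topmost_def above_in_column_def)
      have "j < k" using before_nth[of j k] above j k by (auto simp: before_def above_in_column_def)
      moreover have False if m: "j < m" "m < k" "fst (L ! m) = fst (L ! k)" for m
      proof -
        have "above_in_column (L ! m) (L ! j)"
          using before_nth[of j m] m j k above by (auto simp: before_def above_in_column_def)
        then show False using l nth_eq[of m k] nth_L[of m] m k by (auto simp: topmost_def)
      qed
      ultimately have "below j k" using above by (auto simp: below_def above_in_column_def)
      with \<open>topmost T (L ! k)\<close> show ?thesis by simp
    qed simp
  next
    assume "topmost T (L ! j) \<or> topmost T (L ! k) \<and> below j k"
    then show "topmost (T - {L ! k}) (L ! j)"
    proof
      assume A: "topmost T (L ! k) \<and> below j k"
      have "\<not> above_in_column p (L ! j)" if p: "p \<in> T" "p \<noteq> L ! k" for p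
      proof
        assume above: "above_in_column p (L ! j)"
        obtain m where m: "m \<le> n" "L ! m = p" using ex_nth[OF p(1)] by blast
        have "j < m" using before_nth[of j m] m j above by (auto simp: before_def above_in_column_def)
        moreover have col: "fst p = fst (L ! k)" using A above by (simp add: below_def above_in_column_def)
        moreover have "m \<noteq> k" using m p by auto
        ultimately have "k < m" using A m by (auto simp: below_def)
        then have "above_in_column p (L ! k)"
          using before_nth[of k m] m k col by (auto simp: before_def above_in_column_def)
        then show False using A p by (auto simp: topmost_def)
      qed
      then show ?thesis using ne j by (auto simp: topmost_def)
    qed (use ne in \<open>auto simp: topmost_def\<close>)
  qed
qed

lemma tree_path_remove:
  assumes k: "k < n" and T': "T - {L ! k} \<in> trees"
  shows "tree_path (T - {L ! k}) = delete_nth k (map (step_at (T - {L ! k})) (butlast L))"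
proof -
  have "butlast (delete_nth k L) = delete_nth k (butlast L)"
    using k by (intro nth_equalityI) (auto simp: delete_nth_def nth_append nth_butlast min_def)
  then show ?thesis
    using points_remove[OF fin_T, of k] k by (simp add: tree_path_def delete_nth_map)
qed

text \<open>If the removed point is leftmost, the east step before it becomes diagonal; if it is
  topmost, the north step of the next point below becomes diagonal. Only the first, only the second,
  or both apply in a right, left or diagonal contraction. The position \<open>k\<close> determines
  the index \<open>i\<close>, so the result of the contraction is unique.\<close>

lemma index_contraction_remove:
  assumes k: "k < n" and T': "T - {L ! k} \<in> trees"
  shows "index_contraction \<nu> (tree_path T) k (tree_path (T - {L ! k}))"
    and "index_contraction \<nu> (tree_path T) k w' \<Longrightarrow> w' = tree_path (T - {L ! k})"
proof -
  let ?q = "L ! k" and ?w = "tree_path T" and ?T' = "T - {L ! k}"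
  have q: "?q \<in> T" using k by simp
  note nb = remove_tree_neighbours[OF q T']
  have left: "0 < k" "snd (L ! (k - 1)) = snd ?q" "?w ! (k - 1) = East" "\<not> leftmost T (L ! (k - 1))"
    if lm: "leftmost T ?q"
  proof -
    obtain p where p: "p \<in> T" "p \<noteq> ?q" "snd p = snd ?q" using nb(1) by blast
    obtain m where m: "m \<le> n" "L ! m = p" using ex_nth[OF p(1)] by blast
    have "\<not> left_in_row p ?q" using lm p by (auto simp: leftmost_def)
    then have "m < k" using before_total[OF p(2)] before_nth[of m k] before_nth[of k m] p m k
      by (auto simp: before_def left_in_row_def)
    then show "0 < k" by simp
    have snd: "snd (L ! (k - 1)) = snd ?q"
      using snd_mono[of m "k - 1"] snd_mono[of "k - 1" k] \<open>m < k\<close> k m p by simp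
    then show "snd (L ! (k - 1)) = snd ?q" .
    have "left_in_row ?q (L ! (k - 1))"
      using before_nth[of "k - 1" k] snd \<open>0 < k\<close> k by (auto simp: before_def left_in_row_def)
    then show "\<not> leftmost T (L ! (k - 1))" using q by (auto simp: leftmost_def)
    then show "?w ! (k - 1) = East" using tree_path_nth[of "k - 1"] step_at_iff[of "L ! (k - 1)"] k by simp
  qed
  have top: "\<exists>i. below i k" if tm: "topmost T ?q"
  proof -
    obtain p where p: "p \<in> T" "p \<noteq> ?q" "fst p = fst ?q" using nb(2) by blast
    have "\<not> above_in_column p ?q" using tm p by (auto simp: topmost_def)
    then have "above_in_column ?q p" using p(2,3) by (auto simp: above_in_column_def prod_eq_iff)
    then show ?thesis using ex_below[of k p] k p by auto
  qed
  have belowD: "i < k" "?w ! i = North" "\<not> topmost T (L ! i)" "leftmost T (L ! i)"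
    "last_same_horiz \<nu> (take i ?w) (drop i (take k ?w))" if "below i k" for i
  proof -
    show i: "i < k" using that by (simp add: below_def)
    show "\<not> topmost T (L ! i)" using below_snd[OF that] q k by (auto simp: topmost_def)
    then show "leftmost T (L ! i)" "?w ! i = North"
      using tree_path_nth[of i] step_at_iff[of "L ! i"] tree_extremal[OF T, of "L ! i"] k i by auto
    show "last_same_horiz \<nu> (take i ?w) (drop i (take k ?w))" using last_same_horiz_below that k by simp
  qed
  have below_unique: "i = i'" if "below i k" "below i' k" for i i'
    using that unfolding below_def by (metis linorder_neqE_nat)
  have step': "step_at ?T' (L ! j) = (if leftmost T ?q \<and> Suc j = k \<or> topmost T ?q \<and> below j k
      then Diag else step_at T (L ! j))" if j: "j < n" "j \<noteq> k" for j
  proof -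
    have "snd (L ! j) = snd ?q" if "leftmost T ?q" "Suc j = k" using left(2)[OF that(1)] that(2) by auto
    moreover have "\<not> leftmost T (L ! j)" if "leftmost T ?q" "Suc j = k" using left(4)[OF that(1)] that(2) by auto
    moreover have "topmost T (L ! j)" if "\<not> leftmost T (L ! j)" using that tree_extremal[OF T, of "L ! j"] j by auto
    ultimately show ?thesis
      using leftmost_remove[of j k] topmost_remove[of j k] belowD(3,4)[of j] j k
      unfolding step_at_def by auto
  qed
  have path': "tree_path ?T' = delete_nth k xs"
    if "length xs = n" "\<And>j. j < n \<Longrightarrow> j \<noteq> k \<Longrightarrow> xs ! j = step_at ?T' (L ! j)" for xs
    unfolding tree_path_remove[OF k T'] using that by (intro delete_nth_cong) (auto simp: nth_butlast)
  have right_eq: "tree_path ?T' = delete_nth k (?w[k - 1 := Diag])" if "leftmost T ?q" "\<not> topmost T ?q"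
    using that left(1)[OF that(1)] k
    by (intro path') (auto simp: step' nth_list_update tree_path_nth)
  have left_eq: "tree_path ?T' = delete_nth k (?w[i := Diag])"
    if "\<not> leftmost T ?q" "topmost T ?q" "below i k" for i
  proof (rule path')
    have "below j k \<longleftrightarrow> j = i" for j using below_unique that(3) by blast
    then show "?w[i := Diag] ! j = step_at ?T' (L ! j)" if "j < n" "j \<noteq> k" for j
      using that \<open>\<not> leftmost T ?q\<close> \<open>topmost T ?q\<close> by (simp add: step' nth_list_update tree_path_nth)
  qed simp
  have diag_eq: "tree_path ?T' = delete_nth k (?w[i := Diag, k - 1 := Diag])"
    if "leftmost T ?q" "topmost T ?q" "below i k" for i
  proof (rule path')
    have "below j k \<longleftrightarrow> j = i" for j using below_unique that(3) by blast
    moreover have "Suc j = k \<longleftrightarrow> k - 1 = j" for j using left(1)[OF that(1)] by auto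
    ultimately show "?w[i := Diag, k - 1 := Diag] ! j = step_at ?T' (L ! j)" if "j < n" "j \<noteq> k" for j
      using that \<open>leftmost T ?q\<close> \<open>topmost T ?q\<close>
      by (cases "j = i"; cases "k - 1 = j") (simp_all add: step' nth_list_update tree_path_nth)
  qed simp
  note st = step_at_iff[OF q, folded tree_path_nth[OF k]]
  show "index_contraction \<nu> ?w k (tree_path ?T')"
  proof -
    consider "leftmost T ?q" "\<not> topmost T ?q" | "topmost T ?q" using tree_extremal[OF T q] by blast
    then show ?thesis
    proof cases
      case 1
      then show ?thesis using left[OF 1(1)] st k right_eq by (simp add: index_contraction_def)
    next
      case 2
      then obtain i where i: "below i k" using top by blast
      then have "?w ! k = East \<and> tree_path ?T' = delete_nth k (?w[i := Diag]) \<or>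
          ?w ! (k - 1) = East \<and> ?w ! k = Diag \<and> tree_path ?T' = delete_nth k (?w[i := Diag, k - 1 := Diag])"
        using 2 left(3) st left_eq diag_eq by (cases "leftmost T ?q") auto
      then show ?thesis using belowD[OF i] k unfolding index_contraction_def by auto
    qed
  qed
  show "w' = tree_path ?T'" if c: "index_contraction \<nu> ?w k w'"
  proof (cases "?w ! k = North")
    case True
    then show ?thesis using c st right_eq tree_extremal[OF T q] by (auto simp: index_contraction_def)
  next
    case False
    then obtain i where i: "i < k" "?w ! i = North" "last_same_horiz \<nu> (take i ?w) (drop i (take k ?w))"
      and w': "?w ! k = East \<and> w' = delete_nth k (?w[i := Diag]) \<or>
          ?w ! (k - 1) = East \<and> ?w ! k = Diag \<and> w' = delete_nth k (?w[i := Diag, k - 1 := Diag])"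
      using c unfolding index_contraction_def by auto
    have "below i k" using below_last_same_horiz[OF i(1) _ i(2,3)] k by simp
    then show ?thesis using w' False st left_eq diag_eq by auto
  qed
qed

text \<open>Each kind of contraction exhibits another point in the row, next to an east step at
  \<open>k - 1\<close> or \<open>k\<close>, and another in the column, above a north step at
  \<open>k\<close> or at the position found by \<open>horiz\<close>.\<close>

lemma index_contraction_tree:
  assumes c: "index_contraction \<nu> (tree_path T) k w'"
  shows "k < n" "T - {L ! k} \<in> trees"
proof -
  let ?q = "L ! k" and ?w = "tree_path T"
  show k: "k < n" using c by (simp add: index_contraction_def)
  have q: "?q \<in> T" "?q \<noteq> (0, a)" using k nth_eq[of k n] nth_root by auto
  note st = step_at_iff[OF q(1), folded tree_path_nth[OF k]]
  have row_prev: "\<exists>p\<in>T. p \<noteq> ?q \<and> snd p = snd ?q" if "0 < k" "?w ! (k - 1) = East"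
  proof -
    have "snd (L ! k) = snd (L ! (k - 1))" using snd_Suc[of "k - 1"] that k tree_path_nth[of "k - 1"] by simp
    then show ?thesis using nth_L[of "k - 1"] nth_eq[of "k - 1" k] that k by (intro bexI[of _ "L ! (k - 1)"]) auto
  qed
  have row_left: "\<exists>p\<in>T. p \<noteq> ?q \<and> snd p = snd ?q" if "?w ! k = East"
  proof -
    have "\<not> leftmost T ?q" using that st by simp
    then obtain p where "p \<in> T" "left_in_row p ?q" using q by (auto simp: leftmost_def)
    then show ?thesis by (intro bexI[of _ p]) (auto simp: left_in_row_def)
  qed
  have col_above: "\<exists>p\<in>T. p \<noteq> ?q \<and> fst p = fst ?q" if "?w ! k = North"
  proof -
    have "\<not> topmost T ?q" using that st by simp
    then obtain p where "p \<in> T" "above_in_column p ?q" using q by (auto simp: topmost_def)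
    then show ?thesis by (intro bexI[of _ p]) (auto simp: above_in_column_def)
  qed
  have col_below: "\<exists>p\<in>T. p \<noteq> ?q \<and> fst p = fst ?q" if "below i k" for i
    using that nth_L[of i] nth_eq[of i k] k by (intro bexI[of _ "L ! i"]) (auto simp: below_def)
  show "T - {?q} \<in> trees"
  proof (cases "?w ! k = North")
    case True
    then show ?thesis using c row_prev col_above q remove_tree by (auto simp: index_contraction_def)
  next
    case False
    then obtain i where i: "i < k" "?w ! i = North" "last_same_horiz \<nu> (take i ?w) (drop i (take k ?w))"
      and w': "?w ! k = East \<or> ?w ! (k - 1) = East"
      using c unfolding index_contraction_def by auto
    have "below i k" using below_last_same_horiz[OF i(1) _ i(2,3)] k by simp
    moreover have "0 < k" using i by simp
    ultimately show ?thesis using w' row_left row_prev col_below q remove_tree by blast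
  qed
qed

text \<open>Since \<open>w'\<close> is arbitrary, this also says that a contraction of the path of a
  tree is again the path of a tree.\<close>

lemma path_contraction_tree_iff:
  "path_contraction \<nu> (tree_path T) w' \<longleftrightarrow> (\<exists>q\<in>T. T - {q} \<in> trees \<and> w' = tree_path (T - {q}))"
proof
  assume "path_contraction \<nu> (tree_path T) w'"
  then obtain k where k: "index_contraction \<nu> (tree_path T) k w'" using path_contraction_iff by blast
  note t = index_contraction_tree[OF k]
  then show "\<exists>q\<in>T. T - {q} \<in> trees \<and> w' = tree_path (T - {q})"
    using index_contraction_remove(2)[OF t k] by (intro bexI[of _ "L ! k"]) auto
next
  assume "\<exists>q\<in>T. T - {q} \<in> trees \<and> w' = tree_path (T - {q})"
  then obtain q where q: "q \<in> T" "T - {q} \<in> trees" "w' = tree_path (T - {q})" by blast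
  obtain k where k: "k \<le> n" "L ! k = q" using ex_nth[OF q(1)] by blast
  have "k \<noteq> n" using remove_tree_neighbours(3)[OF q(1,2)] k nth_root by auto
  then have "index_contraction \<nu> (tree_path T) k w'"
    using index_contraction_remove(1)[of k] k q by auto
  then show "path_contraction \<nu> (tree_path T) w'" using path_contraction_iff by blast
qed

end

context nu_path
begin

section \<open>The tree of a path\<close>

text \<open>The columns in which the tree of a path may still have points after \<open>i\<close> steps. The point of the
  tree that belongs to the end point of \<open>take i w\<close> is as far to the right in its row as possible.\<close>

primrec open_cols :: "step list \<Rightarrow> nat \<Rightarrow> nat set" where
  "open_cols w 0 = {..b}"
| "open_cols w (Suc i) = (if w ! i = North then open_cols w i else
     open_cols w i - {Max {x \<in> open_cols w i. (x, snd (end_point (take i w))) \<in> region \<nu>}})"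

definition tree_point :: "step list \<Rightarrow> nat \<Rightarrow> nat \<times> nat" where
  "tree_point w i = (let y = snd (end_point (take i w)) in
     (Max {x \<in> open_cols w i. (x, y) \<in> region \<nu>}, y))"

lemma open_cols_Suc:
  "open_cols w (Suc i) = (if w ! i = North then open_cols w i else open_cols w i - {fst (tree_point w i)})"
  by (simp add: tree_point_def Let_def)

declare open_cols.simps(2) [simp del]

lemma open_cols_mono: "i \<le> j \<Longrightarrow> open_cols w j \<subseteq> open_cols w i"
  by (induction j rule: dec_induct) (auto simp: open_cols_Suc)

lemma open_cols_subset: "open_cols w i \<subseteq> {..b}"
  using open_cols_mono[of 0 i w] by simp

lemma finite_open_cols: "finite (open_cols w i)"
  using open_cols_subset finite_subset by blast

end

context nu_tree
begin

text \<open>If the open columns agree up to step \<open>i\<close>, then by \<open>col_closed\<close>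
  the rightmost open column in the region is that of \<open>L ! i\<close>. So the same column is
  closed next, and the induction continues.\<close>

lemma tree_point_tree_path:
  assumes "i \<le> n"
  shows "open_cols (tree_path T) i = {..b} - closed_cols T i" "tree_point (tree_path T) i = L ! i"
proof -
  have point: "tree_point (tree_path T) i = L ! i"
    if i: "i \<le> n" and op: "open_cols (tree_path T) i = {..b} - closed_cols T i" for i
  proof -
    let ?y = "snd (L ! i)"
    have y: "snd (end_point (take i (tree_path T))) = ?y" using end_point_take[OF i] by simp
    have "Max {x \<in> {..b} - closed_cols T i. (x, ?y) \<in> region \<nu>} = fst (L ! i)"
    proof (rule Max_eqI)
      show "x \<le> fst (L ! i)" if "x \<in> {x \<in> {..b} - closed_cols T i. (x, ?y) \<in> region \<nu>}" for x
        using that col_closed[OF i] by (auto simp: not_less[symmetric])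
      show "fst (L ! i) \<in> {x \<in> {..b} - closed_cols T i. (x, ?y) \<in> region \<nu>}"
        using fst_notin_closed[OF i] nth_region[OF i] region_bounds[of "fst (L ! i)" ?y] by simp
    qed simp
    then show ?thesis by (simp add: tree_point_def y op)
  qed
  show op: "open_cols (tree_path T) i = {..b} - closed_cols T i"
    using assms
  proof (induction i)
    case (Suc i)
    then have "tree_point (tree_path T) i = L ! i" using point[of i] by simp
    then show ?case using Suc step_at_iff[of "L ! i"]
      by (auto simp: open_cols_Suc closed_cols_Suc tree_path_nth)
  qed simp
  show "tree_point (tree_path T) i = L ! i" using point[OF assms op] .
qed

lemma T_eq_tree_points: "T = tree_point (tree_path T) ` {..length (tree_path T)}"
  using ex_nth tree_point_tree_path(2) nth_L by (force simp: image_iff)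

end

locale nu_schroeder_path = nu_path +
  fixes w assumes w: "w \<in> schroeder_paths \<nu>"
begin

abbreviation "m \<equiv> length w"
abbreviation "xc i \<equiv> fst (end_point (take i w))"
abbreviation "yc i \<equiv> snd (end_point (take i w))"
abbreviation "c i \<equiv> fst (tree_point w i)"
abbreviation "opn \<equiv> open_cols w"

lemma snd_tree_point [simp]: "snd (tree_point w i) = yc i"
  by (simp add: tree_point_def Let_def)

lemma point_region: "i \<le> m \<Longrightarrow> (xc i, yc i) \<in> region \<nu>"
proof -
  assume "i \<le> m"
  have "end_point (take i w) \<in> vertices w"
    unfolding vertices_def by (intro CollectI exI[of _ "take i w"] exI[of _ "drop i w"]) simp
  then show ?thesis using w by (auto simp: schroeder_paths_def)
qed

lemma yc_le: "i \<le> m \<Longrightarrow> yc i \<le> a"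
  using point_region region_bounds by blast

lemma end_point_w [simp]: "end_point w = (b, a)"
  using w by (simp add: schroeder_paths_def)

lemma take_Suc_end_point:
  "i < m \<Longrightarrow> end_point (take (Suc i) w) =
     (xc i + (if w ! i = North then 0 else 1), yc i + (if w ! i = East then 0 else 1))"
  by (simp add: take_Suc_conv_app_nth end_point_snoc)

lemma yc_mono: "i \<le> j \<Longrightarrow> j \<le> m \<Longrightarrow> yc i \<le> yc j"
proof (induction j rule: dec_induct)
  case (step j)
  then show ?case using take_Suc_end_point[of j] by simp
qed simp

text \<open>For a diagonal step this is the separate condition in \<open>schroeder_paths\<close>; it
  does not follow from the end points of the step.\<close>

lemma right_step_region:
  assumes i: "i < m" and s: "w ! i \<noteq> North"
  shows "(Suc (xc i), yc i) \<in> region \<nu>"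
proof (cases "w ! i")
  case East
  then show ?thesis using point_region[of "Suc i"] take_Suc_end_point[OF i] i by simp
next
  case Diag
  have "w = take i w @ Diag # drop (Suc i) w" using id_take_nth_drop[OF i] Diag by simp
  then have "end_point (take i w @ [East]) \<in> region \<nu>" using w unfolding schroeder_paths_def by blast
  then show ?thesis by (simp add: end_point_snoc)
qed (use s in simp)

abbreviation "avail i \<equiv> {x \<in> opn i. (x, yc i) \<in> region \<nu>}"

text \<open>Every step that is not north closes one of the \<open>b + 1\<close> columns and moves
  one unit to the right. A closed column met the region when it was closed and still does at greater
  heights. Column 0 is never closed, so the maximum defining \<open>c i\<close> is over a nonempty
  set.\<close>

lemma open_invariant:
  "i \<le> m \<Longrightarrow> 0 \<in> opn i \<and> card (opn i) + xc i = b + 1 \<and> (\<forall>x\<le>b. x \<notin> opn i \<longrightarrow> (x, yc i) \<in> region \<nu>)"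
  "i \<le> m \<Longrightarrow> c i \<in> avail i" "i \<le> m \<Longrightarrow> x \<in> avail i \<Longrightarrow> x \<le> c i"
  "i < m \<Longrightarrow> w ! i \<noteq> North \<Longrightarrow> c i \<noteq> 0"
proof -
  have pt: "c i \<in> avail i \<and> (\<forall>x\<in>avail i. x \<le> c i)"
    if "i \<le> m" "0 \<in> opn i" for i
  proof -
    have "0 \<in> avail i" using that region_col0 yc_le by simp
    moreover have "finite (avail i)" using finite_open_cols by simp
    moreover have "c i = Max (avail i)" by (simp add: tree_point_def Let_def)
    ultimately show ?thesis using Max_in[of "avail i"] Max_ge[of "avail i"] by auto
  qed
  have pos: "c i \<noteq> 0" if i: "i < m" "w ! i \<noteq> North" "0 \<in> opn i" "card (opn i) + xc i = b + 1"
    "\<forall>x\<le>b. x \<notin> opn i \<longrightarrow> (x, yc i) \<in> region \<nu>" for i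
  proof
    assume "c i = 0"
    then have av: "avail i \<subseteq> {0}" using pt[of i] i by auto
    have y: "yc i \<le> a" using yc_le i by simp
    \<comment> \<open>With only column 0 available, all other columns meeting the region in this row
      would be closed. There are just \<open>xc i\<close> closed columns, so no room would remain
      for the step to the right.\<close>
    have "{..width (yc i)} - {0} \<subseteq> {..b} - opn i"
      using av region_iff[OF y] width_le[OF y] by auto
    then have "card ({..width (yc i)} - {0}) \<le> card ({..b} - opn i)" by (intro card_mono) auto
    also have "card ({..b} - opn i) = xc i"
      using i(4) open_cols_subset[of w i] finite_open_cols[of w i] by (simp add: card_Diff_subset)
    finally have "width (yc i) \<le> xc i" by (simp add: card_Diff_singleton)
    then show False using right_step_region[OF i(1,2)] region_iff[OF y] by simp
  qed
  show inv: "0 \<in> opn i \<and> card (opn i) + xc i = b + 1 \<and> (\<forall>x\<le>b. x \<notin> opn i \<longrightarrow> (x, yc i) \<in> region \<nu>)"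
    if "i \<le> m" for i
    using that
  proof (induction i)
    case (Suc i)
    then have i: "i < m" and IH: "0 \<in> opn i" "card (opn i) + xc i = b + 1"
      "\<forall>x\<le>b. x \<notin> opn i \<longrightarrow> (x, yc i) \<in> region \<nu>" by auto
    have ci: "c i \<in> opn i" "(c i, yc i) \<in> region \<nu>" using pt[of i] i IH by auto
    have up: "(x, yc (Suc i)) \<in> region \<nu>" if "(x, yc i) \<in> region \<nu>" for x
      using region_up[OF that] yc_mono[of i "Suc i"] yc_le[of "Suc i"] i by simp
    have "opn (Suc i) = (if w ! i = North then opn i else opn i - {c i})" by (rule open_cols_Suc)
    moreover have "card (opn i - {c i}) = card (opn i) - 1" using ci by simp
    moreover have "card (opn i) \<noteq> 0" using ci finite_open_cols by auto
    ultimately show ?case using IH ci pos[OF i] take_Suc_end_point[OF i] up by auto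
  qed (simp add: region_col0)
  show "c i \<in> avail i" if "i \<le> m" using pt inv that by blast
  show "x \<le> c i" if "i \<le> m" "x \<in> avail i" using pt inv that by blast
  show "c i \<noteq> 0" if "i < m" "w ! i \<noteq> North" using pos inv[of i] that by simp
qed

definition path_tree :: "(nat \<times> nat) set" where
  "path_tree = tree_point w ` {..m}"

text \<open>An east step stays in the row and closes the rightmost available column, so the next
  point lies further left. Every other step goes up.\<close>

lemma before_tree_point:
  assumes "i < j" "j \<le> m"
  shows "before (tree_point w i) (tree_point w j)"
proof -
  have "before (tree_point w i) (tree_point w (Suc i))" if "i < m" for i
  proof (cases "w ! i = East")
    case True
    then have y: "yc (Suc i) = yc i" using take_Suc_end_point[OF that] by simp
    have "c (Suc i) \<in> opn (Suc i)" "(c (Suc i), yc i) \<in> region \<nu>"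
      using open_invariant(2)[of "Suc i"] that y by auto
    then have "c (Suc i) \<in> avail i" "c (Suc i) \<noteq> c i" using True open_cols_Suc[of w i] by auto
    then show ?thesis using open_invariant(3)[of i "c (Suc i)"] that y
      by (simp add: before_def)
  next
    case False
    then show ?thesis using take_Suc_end_point[OF that]
      by (simp add: before_def)
  qed
  note Suc = this
  from \<open>i < j\<close> have "Suc i \<le> j" by simp
  from this \<open>j \<le> m\<close> show ?thesis
  proof (induction j rule: dec_induct)
    case base
    then show ?case using Suc[of i] by simp
  next
    case (step k)
    then show ?case using Suc[of k] before_trans by simp
  qed
qed

lemma open_last: "opn m = {0}" "tree_point w m = (0, a)"
proof -
  have "card (opn m) = 1" "0 \<in> opn m" using open_invariant(1)[of m] by auto
  then show "opn m = {0}" by (metis card_1_singletonE singletonD)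
  then show "tree_point w m = (0, a)" using open_invariant(2)[of m] by (simp add: prod_eq_iff)
qed

lemma closed_col:
  assumes "x \<le> b" "x \<notin> opn i"
  shows "\<exists>j<i. w ! j \<noteq> North \<and> c j = x"
  using assms(2)
proof (induction i)
  case (Suc i)
  then show ?case
    using open_cols_Suc[of w i] by (cases "x \<in> opn i") (auto split: if_splits intro: less_SucI)
qed (use assms in simp)

lemma c_open: "i \<le> j \<Longrightarrow> j \<le> m \<Longrightarrow> c j \<in> opn i"
  using open_invariant(2)[of j] open_cols_mono[of i j w] by auto

lemma before_tree_point_iff:
  "i \<le> m \<Longrightarrow> j \<le> m \<Longrightarrow> before (tree_point w i) (tree_point w j) \<longleftrightarrow> i < j"
  using before_tree_point before_asym by (metis linorder_neqE_nat)

lemma in_path_tree: "j \<le> m \<Longrightarrow> (c j, yc j) \<in> path_tree"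
  unfolding path_tree_def by (rule image_eqI[of _ _ j]) (simp_all add: prod_eq_iff)

text \<open>The column of a later point was already open earlier. If it met the region in the row of
  an earlier point to its left, that earlier point would not have been in the rightmost available
  column.\<close>

lemma path_tree_tree: "path_tree \<in> trees"
  unfolding trees_iff
proof (intro conjI allI impI)
  show "path_tree \<subseteq> region \<nu>"
  proof
    fix p assume "p \<in> path_tree"
    then obtain i where "i \<le> m" "p = tree_point w i" by (auto simp: path_tree_def)
    moreover from this have "p = (c i, yc i)" by (simp add: prod_eq_iff)
    ultimately show "p \<in> region \<nu>" using open_invariant(2)[of i] by simp
  qed
  have "(x', y) \<notin> region \<nu>"
    if p: "(x, y) \<in> path_tree" "(x', y') \<in> path_tree" and less: "x < x'" "y < y'" for x y x' y'
  proof
    assume reg: "(x', y) \<in> region \<nu>"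
    obtain i j where ij: "i \<le> m" "j \<le> m" "x = c i" "y = yc i" "x' = c j" "y' = yc j"
      using p by (auto simp: path_tree_def prod_eq_iff)
    have "i < j" using before_tree_point_iff[of i j] ij less by (simp add: before_def)
    then have "c j \<in> avail i" using c_open[of i j] ij reg by simp
    then show False using open_invariant(3)[of i "c j"] ij less by simp
  qed
  then show "compatible path_tree" unfolding compatible_def by blast
  show "(0, a) \<in> path_tree" using open_last(2) by (force simp: path_tree_def)
  fix y assume "y \<le> a"
  have "\<exists>j\<le>i. yc j = y" if "i \<le> m" "y \<le> yc i" for i y
    using that
  proof (induction i)
    case (Suc i)
    then show ?case
      using take_Suc_end_point[of i] by (cases "y \<le> yc i") (auto intro: le_SucI split: if_splits)
  qed (auto simp: end_point_def)
  from this[of m y] \<open>y \<le> a\<close> obtain j where "j \<le> m" "yc j = y" by auto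
  then show "\<exists>x. (x, y) \<in> path_tree" using in_path_tree[of j] by blast
next
  fix x assume x: "x \<le> b"
  obtain j where "j \<le> m" "c j = x"
  proof (cases "x \<in> opn m")
    case True
    then show thesis using that[of m] open_last by simp
  next
    case False
    then obtain j where "j < m" "c j = x" using closed_col[OF x] by blast
    then show thesis using that[of j] by simp
  qed
  then show "\<exists>y. (x, y) \<in> path_tree" using in_path_tree[of j] by blast
qed

lemma step_at_path_tree:
  assumes i: "i < m"
  shows "step_at path_tree (tree_point w i) = w ! i"
proof -
  have mem: "tree_point w j \<in> path_tree" if "j \<le> m" for j using that by (simp add: path_tree_def)
  have "leftmost path_tree (tree_point w i) \<longleftrightarrow> w ! i \<noteq> East"
  proof
    assume l: "leftmost path_tree (tree_point w i)"
    show "w ! i \<noteq> East"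
    proof
      assume "w ! i = East"
      then have "left_in_row (tree_point w (Suc i)) (tree_point w i)"
        using before_tree_point[of i "Suc i"] take_Suc_end_point[OF i] i
        by (simp add: before_def left_in_row_def)
      then show False using l mem[of "Suc i"] i by (auto simp: leftmost_def)
    qed
  next
    assume "w ! i \<noteq> East"
    then have y: "yc i < yc (Suc i)" using take_Suc_end_point[OF i] by simp
    have "\<not> left_in_row (tree_point w j) (tree_point w i)" if j: "j \<le> m" for j
    proof
      assume left: "left_in_row (tree_point w j) (tree_point w i)"
      then have "i < j" using before_tree_point_iff[of i j] i j by (auto simp: before_def left_in_row_def)
      then have "yc i < yc j" using y yc_mono[of "Suc i" j] j by simp
      then show False using left by (simp add: left_in_row_def)
    qed
    then show "leftmost path_tree (tree_point w i)"
      using mem[of i] i by (auto simp: leftmost_def path_tree_def)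
  qed
  moreover have "topmost path_tree (tree_point w i) \<longleftrightarrow> w ! i \<noteq> North"
  proof
    assume t: "topmost path_tree (tree_point w i)"
    show "w ! i \<noteq> North"
    proof
      assume N: "w ! i = North"
      have ci: "c i \<in> opn i" "c i \<le> b" using c_open[of i i] open_cols_subset[of w i] i by auto
      \<comment> \<open>A north step leaves its column open, so the column is visited again: by the
        step that closes it, or by the final point if it is column 0.\<close>
      obtain j where j: "i < j" "j \<le> m" "c j = c i"
      proof (cases "c i \<in> opn m")
        case True
        then show thesis using that[of m] i open_last by simp
      next
        case False
        then obtain j where j: "j < m" "w ! j \<noteq> North" "c j = c i" using closed_col ci by blast
        have "\<not> j < i"
        proof
          assume "j < i"
          then have "c i \<in> opn (Suc j)" using c_open[of "Suc j" i] i by simp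
          then show False using j open_cols_Suc[of w j] by simp
        qed
        moreover have "j \<noteq> i" using j N by auto
        ultimately have "i < j" by simp
        then show thesis using that[of j] j by simp
      qed
      then have "above_in_column (tree_point w j) (tree_point w i)"
        using before_tree_point[of i j] by (simp add: before_def above_in_column_def)
      then show False using t mem[of j] j by (auto simp: topmost_def)
    qed
  next
    assume N: "w ! i \<noteq> North"
    have "\<not> above_in_column (tree_point w j) (tree_point w i)" if j: "j \<le> m" for j
    proof
      assume above: "above_in_column (tree_point w j) (tree_point w i)"
      then have "i < j" using before_tree_point_iff[of i j] i j by (auto simp: before_def above_in_column_def)
      then have "c j \<in> opn (Suc i)" using c_open[of "Suc i" j] j by simp
      then show False using N above open_cols_Suc[of w i] by (simp add: above_in_column_def)
    qed
    then show "topmost path_tree (tree_point w i)"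
      using mem[of i] i by (auto simp: topmost_def path_tree_def)
  qed
  ultimately show ?thesis by (cases "w ! i") (simp_all add: step_at_def)
qed

lemma tree_path_path_tree: "tree_path path_tree = w"
proof -
  have "points path_tree = map (tree_point w) [0..<Suc m]"
  proof (rule points_unique)
    show "sorted_wrt before (map (tree_point w) [0..<Suc m])"
      unfolding sorted_wrt_iff_nth_less using before_tree_point by (auto simp del: upt_Suc)
    show "set (map (tree_point w) [0..<Suc m]) = path_tree"
      unfolding path_tree_def by (auto simp del: upt_Suc simp: less_Suc_eq_le)
  qed
  then have "tree_path path_tree = map (\<lambda>i. step_at path_tree (tree_point w i)) [0..<m]"
    by (simp add: tree_path_def)
  also have "\<dots> = map (\<lambda>i. w ! i) [0..<m]" using step_at_path_tree by simp
  finally show ?thesis by (simp add: map_nth)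
qed

end

section \<open>Trees and paths as instances of the model\<close>

context nu_path
begin

definition tree_of_path :: "step list \<Rightarrow> (nat \<times> nat) set" where
  "tree_of_path w = tree_point w ` {..length w}"

lemma tree_of_path_tree_path: "T \<in> trees \<Longrightarrow> tree_of_path (tree_path T) = T"
  using nu_tree.T_eq_tree_points[OF nu_tree.intro[OF nu_path_axioms nu_tree_axioms.intro]]
  by (simp add: tree_of_path_def)

lemma nu_schroeder_path: "w \<in> schroeder_paths \<nu> \<Longrightarrow> nu_schroeder_path \<nu> a b w"
  by (intro nu_schroeder_path.intro nu_path_axioms nu_schroeder_path_axioms.intro)

lemma tree_of_path:
  assumes "w \<in> schroeder_paths \<nu>"
  shows "tree_of_path w \<in> trees" "tree_path (tree_of_path w) = w"
proof -
  interpret nu_schroeder_path \<nu> a b w using assms by (rule nu_schroeder_path)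
  show "tree_of_path w \<in> trees" "tree_path (tree_of_path w) = w"
    using path_tree_tree tree_path_path_tree by (simp_all add: tree_of_path_def path_tree_def)
qed

lemma tree_path_in_schroeder_paths: "T \<in> trees \<Longrightarrow> tree_path T \<in> schroeder_paths \<nu>"
  using nu_tree.tree_path_in_paths[OF nu_tree.intro[OF nu_path_axioms nu_tree_axioms.intro]] .

lemma path_contraction_tree_path:
  assumes "S \<in> trees" "S' \<in> trees"
  shows "path_contraction \<nu> (tree_path S) (tree_path S') \<longleftrightarrow> (\<exists>q\<in>S. S' = S - {q})"
proof -
  interpret nu_tree \<nu> a b S using assms by unfold_locales
  show ?thesis
    unfolding path_contraction_tree_iff using assms(2) by (metis tree_of_path_tree_path)
qed

lemma tree_model_trees: "tree_model \<nu> a b trees (tree_contraction \<nu>) id"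
  by unfold_locales (auto simp: tree_contraction_iff)

lemma tree_model_paths: "tree_model \<nu> a b (schroeder_paths \<nu>) (path_contraction \<nu>) tree_of_path"
proof unfold_locales
  show "bij_betw tree_of_path (schroeder_paths \<nu>) trees"
    by (rule bij_betwI[where g = tree_path])
      (auto simp: tree_of_path tree_of_path_tree_path tree_path_in_schroeder_paths)
  show "path_contraction \<nu> x y \<longleftrightarrow> (\<exists>q\<in>tree_of_path x. tree_of_path y = tree_of_path x - {q})"
    if "x \<in> schroeder_paths \<nu>" "y \<in> schroeder_paths \<nu>" for x y
    using path_contraction_tree_path[of "tree_of_path x" "tree_of_path y"] tree_of_path that by simp
qed

end

theorem theorem4p9:
  fixes \<nu> :: "step list" and a b :: nat
  assumes "lattice_path \<nu> (b, a)"
  shows "(let P = adjoin_bounds (path_poset \<nu>) in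
            lattice P \<and> eulerian_intervals (P\<lparr>carrier := carrier P - {One_hat}\<rparr>)) \<and>
         (let P = adjoin_bounds (tree_poset \<nu>) in
            lattice P \<and> eulerian_intervals (P\<lparr>carrier := carrier P - {One_hat}\<rparr>))"
proof -
  interpret nu_path \<nu> a b using assms by unfold_locales
  interpret trees: tree_model \<nu> a b trees "tree_contraction \<nu>" id by (rule tree_model_trees)
  interpret paths: tree_model \<nu> a b "schroeder_paths \<nu>" "path_contraction \<nu>" tree_of_path
    by (rule tree_model_paths)
  show ?thesis
    unfolding Let_def path_poset_def tree_poset_def
    using trees.lattice_H trees.eulerian_intervals_H paths.lattice_H paths.eulerian_intervals_H by blast
qed

end
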